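(* Let $(\Gamma,\alpha)$ be a $d$-valent abstract one-skeleton which is 3-independent and non-cyclic, with $\alpha$ taking values in $\mathfrak g^*$, $\dim\mathfrak g^*=n$. Then for every integer $m\ge 0$ $$\dim H^{2m}(\Gamma,\alpha)=\sum_{k=0}^{d} b_{2k}(\Gamma)\,\lambda_{m-k,n}.$$
   Context: $\mathfrak g$ is an $n$-dimensional real vector space, $\mathfrak g^*$ its dual, $\mathbb S(\mathfrak g^* )=\bigoplus_k\mathbb S^k(\mathfrak g^* )$ the symmetric algebra (polynomial functions on $\mathfrak g$). $\lambda_{k,n}=\dim \mathbb S^k(\mathfrak g^* )$ if $k\ge0$ and $\lambda_{k,n}=0$ if $k<0$. Abstract one-skeleton: a finite $d$-valent graph $\Gamma$ (multiple edges allowed) with vertex set $V_\Gamma$ and set $E_\Gamma$ of oriented edges (each edge occurs with both orientations; $i(e),t(e)$ are the initial and terminal vertices of $e$, $\bar e$ is $e$ reversed, $E_p=\{e: i(e)=p\}$ has $d$ elements), a connection $\theta$, i.e. bijections $\theta_e:E_{i(e)}\to E_{t(e)}$ with $\theta_{\bar e}=\theta_e^{-1}$, and an axial function $\alpha:E_\Gamma\to\mathfrak g^*$ such that: (A1) for every $p$ the vectors $\alpha_e$, $e\in E_p$, are pairwise linearly independent; (A2) for every $e$ there are positive numbers $m_e,m_{\bar e}$ with $m_{\bar e}\alpha_{\bar e}=-m_e\alpha_e$; (A3) for every $e\in E_\Gamma$ and $e_i\in E_{i(e)}$, $\alpha_{\theta_e(e_i)}=\lambda_{i,e}\alpha_{e_i}+c_{i,e}\alpha_e$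 with $\lambda_{i,e}>0$, $c_{i,e}\in\mathbb R$. 3-independent: for every vertex $p$ and any three distinct edges in $E_p$, the three values of $\alpha$ are linearly independent. Polarizing vectors: $\mathcal P=\{\xi\in\mathfrak g:\alpha_e(\xi)\ne0\ \forall e\in E_\Gamma\}$. For $\xi\in\mathcal P$ the index $\sigma_p$ of a vertex $p$ is the number of $e\in E_p$ with $\alpha_e(\xi)<0$; $b_{2i}(\Gamma)$ is the number of vertices of index $i$; this is independent of $\xi\in\mathcal P$. The same definitions apply to a connected component of a subgraph $\Gamma_{\mathfrak h}$ (below) using its own edges. For a subspace $\mathfrak h\subset\mathfrak g$, $\Gamma_{\mathfrak h}$ is the subgraph whose edges are those $e$ with $\alpha_e\in\mathfrak h^\perp$ (annihilator of $\mathfrak h$). Non-cyclic: (NCA1) for some $\xi\in\mathcal P$, the graph $\Gamma$ with each edge oriented so that $\alpha_e(\xi)>0$ has no oriented cycles; (NCA2) for every codimension 2 subspace $\mathfrak h$ of $\mathfrak g$, every connected component $\Gamma_0$ of $\Gamma_{\mathfrak h}$ has $b_0(\Gamma_0)=1$. Cohomology ring: $H(\Gamma,\alpha)$ is the ring of maps $f:V_\Gamma\to\mathbb S(\mathfrak g^* )$ such that $f(i(e))-f(t(e))\in\alpha_e\,\mathbb S(\mathfrak g^* )$ for every $e\in E_\Gamma$; $H^{2m}(\Gamma,\alpha)$ is the subspace of those $f$ with values in $\mathbb S^m(\mathfrak g^* )$. *)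

theory Defs
  imports Complex_Main "HOL-Library.Function_Algebras" "Graph_Theory.Graph_Theory"
begin

section \<open>Real-valued functions as a vector space\<close>

text \<open>
  Pointwise scaling. With it the notions \<^const>\<open>span\<close>, \<^const>\<open>dim\<close> and independence apply to the
  dual space (functionals \<^typ>\<open>'g \<Rightarrow> real\<close>), to polynomial functions (same type), and to
  vertex-indexed families of polynomial functions (\<^typ>\<open>'v \<Rightarrow> 'g \<Rightarrow> real\<close>).
\<close>

instantiation "fun" :: (type, scaleR) scaleR
begin

definition scaleR_fun_def: "c *\<^sub>R f = (\<lambda>x. c *\<^sub>R f x)"

instance ..

end

lemma scaleR_fun_apply [simp]: "(c *\<^sub>R f) x = c *\<^sub>R f x"
  by (simp add: scaleR_fun_def)

instance "fun" :: (type, real_vector) real_vector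
  by standard (simp_all add: fun_eq_iff scaleR_add_right scaleR_add_left)

definition finite_dim :: "'a::real_vector set \<Rightarrow> bool" where
  "finite_dim V \<longleftrightarrow> (\<exists>B. finite B \<and> V \<subseteq> span B)"

text \<open>
  Linear independence of a family; a repeated vector makes the family dependent, which
  independence of the image set alone would not detect.
\<close>

definition indep_family :: "('i \<Rightarrow> 'a::real_vector) \<Rightarrow> 'i set \<Rightarrow> bool" where
  "indep_family v I \<longleftrightarrow> inj_on v I \<and> independent (v ` I)"


section \<open>The symmetric algebra of the dual, as polynomial functions\<close>

definition sym_power :: "nat \<Rightarrow> ('g::real_vector \<Rightarrow> real) set" where
  "sym_power k = span {\<Prod>i<k. l i | l. \<forall>i<k. linear (l i)}"

definition sym_algebra :: "('g::real_vector \<Rightarrow> real) set" where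
  "sym_algebra = span (\<Union>k. sym_power k)"

text \<open>
  The number \<open>\<lambda>\<^sub>k\<^sub>,\<^sub>n\<close>, where \<open>n\<close> is the dimension of \<^typ>\<open>'g\<close>.
\<close>

definition sym_dim :: "'g::real_vector itself \<Rightarrow> int \<Rightarrow> nat" where
  "sym_dim _ k = (if k \<ge> 0 then dim (sym_power (nat k) :: ('g \<Rightarrow> real) set) else 0)"

definition annihilator :: "'g::real_vector set \<Rightarrow> ('g \<Rightarrow> real) set" where
  "annihilator h = {\<phi>. linear \<phi> \<and> (\<forall>x\<in>h. \<phi> x = 0)}"


section \<open>Abstract one-skeleta\<close>

text \<open>
  The arcs of \<open>G\<close> are the oriented edges, \<open>tail G e\<close> and \<open>head G e\<close> are the initial and the
  terminal vertex of \<open>e\<close>, \<open>arev e\<close> is the reversed edge, and \<open>out_arcs G p\<close> is the set of edges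
  starting at \<open>p\<close>. Parallel arcs are allowed.
\<close>

locale abstract_one_skeleton = fin_digraph G + bidirected_digraph G arev
  for G :: "('v, 'e) pre_digraph" and arev :: "'e \<Rightarrow> 'e" +
  fixes d :: nat
    and \<theta> :: "'e \<Rightarrow> 'e \<Rightarrow> 'e"
    and \<alpha> :: "'e \<Rightarrow> 'g::real_vector \<Rightarrow> real"
  assumes valent: "\<And>p. p \<in> verts G \<Longrightarrow> card (out_arcs G p) = d"
    and connection_bij: "\<And>e. e \<in> arcs G \<Longrightarrow>
          bij_betw (\<theta> e) (out_arcs G (tail G e)) (out_arcs G (head G e))"
    and connection_inv: "\<And>e e'. e \<in> arcs G \<Longrightarrow> e' \<in> out_arcs G (head G e) \<Longrightarrow>
          \<theta> (arev e) e' = inv_into (out_arcs G (tail G e)) (\<theta> e) e'"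
    and axial_linear: "\<And>e. e \<in> arcs G \<Longrightarrow> linear (\<alpha> e)"
    and A1: "\<And>p e e'. p \<in> verts G \<Longrightarrow> e \<in> out_arcs G p \<Longrightarrow> e' \<in> out_arcs G p \<Longrightarrow> e \<noteq> e' \<Longrightarrow>
          indep_family \<alpha> {e, e'}"
    and A2: "\<And>e. e \<in> arcs G \<Longrightarrow>
          \<exists>m m'. m > 0 \<and> m' > 0 \<and> m' *\<^sub>R \<alpha> (arev e) = - (m *\<^sub>R \<alpha> e)"
    and A3: "\<And>e e'. e \<in> arcs G \<Longrightarrow> e' \<in> out_arcs G (tail G e) \<Longrightarrow>
          \<exists>l c. l > 0 \<and> \<alpha> (\<theta> e e') = l *\<^sub>R \<alpha> e' + c *\<^sub>R \<alpha> e"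

definition three_independent ::
    "('v, 'e) pre_digraph \<Rightarrow> ('e \<Rightarrow> 'g::real_vector \<Rightarrow> real) \<Rightarrow> bool" where
  "three_independent G \<alpha> \<longleftrightarrow>
     (\<forall>p\<in>verts G. \<forall>e\<^sub>1\<in>out_arcs G p. \<forall>e\<^sub>2\<in>out_arcs G p. \<forall>e\<^sub>3\<in>out_arcs G p.
        e\<^sub>1 \<noteq> e\<^sub>2 \<and> e\<^sub>1 \<noteq> e\<^sub>3 \<and> e\<^sub>2 \<noteq> e\<^sub>3 \<longrightarrow> indep_family \<alpha> {e\<^sub>1, e\<^sub>2, e\<^sub>3})"

definition polarizing ::
    "('v, 'e) pre_digraph \<Rightarrow> ('e \<Rightarrow> 'g::real_vector \<Rightarrow> real) \<Rightarrow> 'g set" where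
  "polarizing G \<alpha> = {\<xi>. \<forall>e\<in>arcs G. \<alpha> e \<xi> \<noteq> 0}"

definition vertex_index ::
    "('v, 'e) pre_digraph \<Rightarrow> ('e \<Rightarrow> 'g::real_vector \<Rightarrow> real) \<Rightarrow> 'g \<Rightarrow> 'v \<Rightarrow> nat" where
  "vertex_index G \<alpha> \<xi> p = card {e \<in> out_arcs G p. \<alpha> e \<xi> < 0}"

text \<open>
  \<open>betti G \<alpha> i\<close> is the number \<open>b\<^sub>2\<^sub>i\<close>, computed with an arbitrarily chosen polarizing vector. For
  one-skeleta it does not depend on the choice.
\<close>

definition betti ::
    "('v, 'e) pre_digraph \<Rightarrow> ('e \<Rightarrow> 'g::real_vector \<Rightarrow> real) \<Rightarrow> nat \<Rightarrow> nat" where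
  "betti G \<alpha> i =
     card {p \<in> verts G. vertex_index G \<alpha> (SOME \<xi>. \<xi> \<in> polarizing G \<alpha>) p = i}"

text \<open>
  The subgraph \<open>\<Gamma>\<^sub>h\<close> keeps all vertices. A vertex without edges in \<open>\<Gamma>\<^sub>h\<close> is a component with
  \<open>b\<^sub>0 = 1\<close>, so keeping it does not affect the condition on components below.
\<close>

definition annihilated_subgraph ::
    "('v, 'e) pre_digraph \<Rightarrow> ('e \<Rightarrow> 'g::real_vector \<Rightarrow> real) \<Rightarrow> 'g set \<Rightarrow> ('v, 'e) pre_digraph" where
  "annihilated_subgraph G \<alpha> h = G\<lparr>arcs := {e \<in> arcs G. \<alpha> e \<in> annihilator h}\<rparr>"

definition components :: "('v, 'e) pre_digraph \<Rightarrow> ('v, 'e) pre_digraph set" where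
  "components G = {C. pre_digraph.max_subgraph G Digraph_Component.connected C}"

definition non_cyclic ::
    "('v, 'e) pre_digraph \<Rightarrow> ('e \<Rightarrow> 'g::real_vector \<Rightarrow> real) \<Rightarrow> bool" where
  "non_cyclic G \<alpha> \<longleftrightarrow>
     (\<exists>\<xi>\<in>polarizing G \<alpha>. \<nexists>c. pre_digraph.cycle (G\<lparr>arcs := {e \<in> arcs G. \<alpha> e \<xi> > 0}\<rparr>) c) \<and>
     (\<forall>h. subspace h \<and> dim h + 2 = dim (UNIV :: 'g set) \<longrightarrow>
        (\<forall>C\<in>components (annihilated_subgraph G \<alpha> h). betti C \<alpha> 0 = 1))"


section \<open>The cohomology ring\<close>

text \<open>
  Maps on the vertex set are represented by functions that vanish outside of it.
\<close>

definition cohomology ::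
    "('v, 'e) pre_digraph \<Rightarrow> ('e \<Rightarrow> 'g::real_vector \<Rightarrow> real) \<Rightarrow> ('v \<Rightarrow> 'g \<Rightarrow> real) set" where
  "cohomology G \<alpha> =
     {f. (\<forall>p\<in>verts G. f p \<in> sym_algebra) \<and> (\<forall>p. p \<notin> verts G \<longrightarrow> f p = 0) \<and>
         (\<forall>e\<in>arcs G. \<exists>q\<in>sym_algebra. f (tail G e) - f (head G e) = \<alpha> e * q)}"

text \<open>\<open>cohomology_part G \<alpha> m\<close> is the piece of degree \<open>2 m\<close>.\<close>

definition cohomology_part ::
    "('v, 'e) pre_digraph \<Rightarrow> ('e \<Rightarrow> 'g::real_vector \<Rightarrow> real) \<Rightarrow> nat \<Rightarrow> ('v \<Rightarrow> 'g \<Rightarrow> real) set" where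
  "cohomology_part G \<alpha> m = {f \<in> cohomology G \<alpha>. \<forall>p\<in>verts G. f p \<in> sym_power m}"

end

theory Submission
  imports Defs
begin

text \<open>
  Order the vertices so that edges with \<open>\<alpha>\<^sub>e(\<xi>) > 0\<close> go up (NCA1) and build the classes one vertex
  at a time. A class on the vertices below \<open>p\<close> extends to \<open>p\<close> iff its values at the lower
  neighbours of \<open>p\<close> can be interpolated: one needs a polynomial with prescribed restrictions to
  the hyperplanes \<open>ker \<alpha>\<^sub>e\<close>, \<open>e\<close> running over the descending edges at \<open>p\<close>. As no three of
  these hyperplanes meet in codimension 2 (3-independence), it suffices that the prescribed
  values agree on pairwise intersections. For two descending edges the intersection \<open>h\<close> has
  codimension 2, and in the component of \<open>\<Gamma>\<^sub>h\<close> through \<open>p\<close> both neighbours descend to the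
  unique local minimum (NCA2), along edges on which the class is constant when restricted to \<open>h\<close>.
  The extensions differ by multiples of the product of the \<open>\<alpha>\<^sub>e\<close> over the descending edges at
  \<open>p\<close>, so \<open>p\<close> contributes \<open>\<lambda>\<close> of \<open>m - \<sigma>\<^sub>p\<close> to the dimension. The Betti numbers do not depend on
  \<open>\<xi>\<close> by a wall-crossing argument.
\<close>


section \<open>Linear algebra in spaces of arbitrary dimension\<close>

text \<open>Polynomials are represented by functions on a real vector space without topology.
  Divisibility is therefore obtained by evaluation: vanishing on a hyperplane produces a quotient,
  and a linear form is cancelled by a limit along a line. Quotients and interpolants carry no
  degree; this is repaired by passing to a homogeneous component that keeps the values wherever
  homogeneity is already known. The obstacle in the descent argument is that (NCA2) counts minima
  with an arbitrarily chosen polarizing vector, whereas the vertex order belongs to the vector of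
  (NCA1). Hence independence of the vector is needed for the components of the annihilated
  subgraphs, and not only for the whole graph. Since \<open>dim\<close> alone does not say that a
  space is finite-dimensional, finiteness is carried along with every dimension.\<close>

lemma finite_dim_subset: "finite_dim B \<Longrightarrow> A \<subseteq> B \<Longrightarrow> finite_dim A"
  unfolding finite_dim_def by blast

lemma finite_dim_basis:
  assumes "finite_dim A"
  obtains B where "B \<subseteq> A" "independent B" "A \<subseteq> span B" "card B = dim A" "finite B"
proof -
  obtain B where B: "B \<subseteq> A" "independent B" "A \<subseteq> span B" "card B = dim A"
    using real_vector.basis_exists[of A] by metis
  obtain F where F: "finite F" "A \<subseteq> span F"
    using assms unfolding finite_dim_def by blast
  from real_vector.independent_span_bound[OF F(1) B(2)] B(1) F(2)
  have "finite B" by blast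
  with B that show thesis by blast
qed

text \<open>The coordinates of \<open>x\<close> with respect to \<open>B\<close> are supported both
  in \<open>C\<close> and in its complement, so all of them are zero.\<close>

lemma independent_spans_disjoint:
  assumes "independent B" "C \<subseteq> B" "x \<in> span C" "x \<in> span (B - C)"
  shows "x = 0"
proof -
  have 1: "real_vector.representation B x = real_vector.representation C x"
    using assms by (intro real_vector.representation_extend) auto
  have 2: "real_vector.representation B x = real_vector.representation (B - C) x"
    using assms by (intro real_vector.representation_extend) auto
  have "real_vector.representation B x b = 0" for b
    using real_vector.representation_ne_zero[of C x b] real_vector.representation_ne_zero[of "B - C" x b] 1 2
    by (metis DiffD2)
  moreover have "x \<in> span B"
    using assms(2,3) real_vector.span_mono by blast
  ultimately show ?thesis
    using real_vector.sum_nonzero_representation_eq[OF assms(1), of x] by simp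
qed

text \<open>A basis \<open>C\<close> of the kernel extends to a basis \<open>B\<close> of
  \<open>A\<close>, and \<open>T\<close> is injective on the span of \<open>B - C\<close>.
  Finiteness of \<open>A\<close> is part of the conclusion, because the spaces of classes are shown
  finite-dimensional by this very argument, one vertex at a time.\<close>

lemma rank_nullity:
  fixes T :: "'a::real_vector \<Rightarrow> 'b::real_vector"
  assumes T: "linear T" and A: "subspace A"
    and fin_image: "finite_dim (T ` A)" and fin_ker: "finite_dim (A \<inter> {x. T x = 0})"
  shows "finite_dim A \<and> dim A = dim (T ` A) + dim (A \<inter> {x. T x = 0})"
proof -
  let ?K = "A \<inter> {x. T x = 0}"
  obtain C where C: "C \<subseteq> ?K" "independent C" "?K \<subseteq> span C" "card C = dim ?K" "finite C"
    using finite_dim_basis[OF fin_ker] by metis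
  obtain B where B: "C \<subseteq> B" "B \<subseteq> A" "independent B" "A \<subseteq> span B"
    using real_vector.maximal_independent_subset_extend[of C A] C by auto
  have spanA: "span B = A"
    using B A by (simp add: real_vector.span_subspace)
  have "inj_on T (span (B - C))"
    unfolding linear_inj_on_iff_eq_0[OF T real_vector.subspace_span]
  proof (intro ballI impI)
    fix x assume x: "x \<in> span (B - C)" "T x = 0"
    then have "x \<in> A"
      using real_vector.span_mono[of "B - C" B] spanA by blast
    with x C(3) have "x \<in> span C" by blast
    with independent_spans_disjoint[OF B(3,1)] x(1) show "x = 0" by blast
  qed
  moreover have "independent (B - C)"
    using B(3) real_vector.independent_mono by blast
  ultimately have ind: "independent (T ` (B - C))" and inj: "inj_on T (B - C)"
    using linear_independent_injective_image[OF T] real_vector.span_superset inj_on_subset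
    by (metis, metis)
  have sp: "T ` A \<subseteq> span (T ` (B - C))"
  proof
    fix y assume "y \<in> T ` A"
    then obtain x where x: "x \<in> span B" "y = T x" using spanA by blast
    have "B = C \<union> (B - C)" using B(1) by blast
    then obtain u v where uv: "x = u + v" "u \<in> span C" "v \<in> span (B - C)"
      using x(1) real_vector.span_Un[of C "B - C"] by auto
    have "subspace ?K"
      using A T real_vector.subspace_inter linear_subspace_kernel by blast
    then have "u \<in> ?K"
      using uv(2) C(1) real_vector.span_minimal by blast
    then have "y = T v" using x uv T by (simp add: linear_add)
    then show "y \<in> span (T ` (B - C))"
      using uv(3) linear_span_image[OF T] by blast
  qed
  have sub: "T ` (B - C) \<subseteq> T ` A" using B by blast
  have "card (T ` (B - C)) = dim (T ` A)"
    by (rule real_vector.basis_card_eq_dim[OF sub sp ind])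
  moreover have finT: "finite (T ` (B - C))"
    using fin_image ind sub real_vector.independent_span_bound unfolding finite_dim_def
    by (meson subset_trans)
  ultimately have "finite (B - C)" "card (B - C) = dim (T ` A)"
    using inj finite_image_iff card_image by metis+
  then have "finite B" "card B = dim (T ` A) + dim ?K"
    using C(4,5) B(1) by (auto simp: card_Diff_subset card_mono dest: card_mono[of B C])
  moreover have "card B = dim A"
    by (rule real_vector.basis_card_eq_dim[OF B(2,4,3)])
  ultimately show ?thesis
    using B(4) unfolding finite_dim_def by auto
qed

lemma dim_kernel_functional:
  fixes \<phi> :: "'a::real_vector \<Rightarrow> real"
  assumes "linear \<phi>" "subspace A" "finite_dim A" "v \<in> A" "\<phi> v \<noteq> 0"
  shows "dim A = Suc (dim (A \<inter> {x. \<phi> x = 0}))"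
proof -
  have "\<phi> ` A = UNIV"
  proof -
    have "r \<in> \<phi> ` A" for r
      using assms by (intro image_eqI[of _ _ "(r / \<phi> v) *\<^sub>R v"])
        (auto simp: linear_cmul real_vector.subspace_scale)
    then show ?thesis by blast
  qed
  moreover have span1: "UNIV \<subseteq> span {1::real}"
    using real_vector.span_breakdown_eq[of _ "1::real" "{}"] by (auto simp: real_vector.span_singleton)
  moreover have "dim (UNIV :: real set) = 1"
    using real_vector.basis_card_eq_dim[of "{1::real}" UNIV] span1 by simp
  moreover have "finite_dim (UNIV :: real set)"
    using span1 unfolding finite_dim_def by blast
  ultimately show ?thesis
    using rank_nullity[OF assms(1,2)] finite_dim_subset[OF assms(3)] by auto
qed

lemma dim_image_inj:
  fixes T :: "'a::real_vector \<Rightarrow> 'b::real_vector"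
  assumes "linear T" "subspace A" "finite_dim A" "\<And>x. x \<in> A \<Longrightarrow> T x = 0 \<Longrightarrow> x = 0"
  shows "finite_dim (T ` A) \<and> dim (T ` A) = dim A"
proof -
  obtain B where B: "finite B" "A \<subseteq> span B"
    using assms(3) unfolding finite_dim_def by blast
  have "finite_dim (T ` A)"
    unfolding finite_dim_def
    using B linear_span_image[OF assms(1), of B] by (intro exI[of _ "T ` B"]) auto
  moreover have "A \<inter> {x. T x = 0} = {0}"
    using assms real_vector.subspace_0 linear_0 by blast
  moreover have "dim {0::'a} = 0"
    using real_vector.dim_le_card[of "{0::'a}" "{}"] by simp
  moreover have "finite_dim {0::'a}"
    unfolding finite_dim_def using real_vector.span_zero by blast
  ultimately show ?thesis
    using rank_nullity[OF assms(1,2)] by simp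
qed

text \<open>This is what later turns linear independence of axial values into vectors that separate
  them. If the common kernel of \<open>F\<close> lies in the kernel of \<open>a\<close>, then
  \<open>a\<close> adds nothing; otherwise a multiple of \<open>a\<close> is split off.\<close>

lemma functional_in_span:
  fixes \<phi> :: "'a::real_vector \<Rightarrow> real"
  assumes "finite F" "\<forall>a\<in>F. linear a" "linear \<phi>" "\<And>x. \<forall>a\<in>F. a x = 0 \<Longrightarrow> \<phi> x = 0"
  shows "\<phi> \<in> span F"
  using assms
proof (induction F arbitrary: \<phi> rule: finite_induct)
  case empty
  then have "\<phi> = 0" by (simp add: fun_eq_iff)
  then show ?case by (simp add: real_vector.span_zero del: zero_fun_apply)
next
  case (insert a F)
  show ?case
  proof (cases "\<exists>v. (\<forall>b\<in>F. b v = 0) \<and> a v \<noteq> 0")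
    case False
    have "\<phi> \<in> span F"
    proof (rule insert.IH)
      show "\<phi> x = 0" if "\<forall>b\<in>F. b x = 0" for x
        using False that by (intro insert.prems(3)) auto
    qed (use insert.prems in auto)
    then show ?thesis using real_vector.span_mono[of F "insert a F"] by blast
  next
    case True
    then obtain v where v: "\<forall>b\<in>F. b v = 0" "a v \<noteq> 0" by blast
    \<comment> \<open>The multiple of \<open>a\<close> makes \<open>?\<psi>\<close> kill
      \<open>v\<close>. Moving \<open>x\<close> along \<open>v\<close> into the kernel of
      \<open>a\<close> therefore does not change \<open>?\<psi> x\<close>, and there both terms
      vanish.\<close>
    let ?\<psi> = "\<phi> - (\<phi> v / a v) *\<^sub>R a"
    have "?\<psi> \<in> span F"
    proof (rule insert.IH)
      show "linear ?\<psi>"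
        using insert.prems(1,2)
        by (auto simp: linear_iff algebra_simps add_divide_distrib)
      fix x assume x: "\<forall>b\<in>F. b x = 0"
      have "\<phi> (x - (a x / a v) *\<^sub>R v) = 0"
        using insert.prems(1) v x
        by (intro insert.prems(3)) (auto simp: linear_diff linear_cmul)
      then show "?\<psi> x = 0"
        using insert.prems(2) by (simp add: linear_diff linear_cmul field_simps)
    qed (use insert in auto)
    then have "?\<psi> + (\<phi> v / a v) *\<^sub>R a \<in> span (insert a F)"
      using real_vector.span_mono[of F "insert a F"]
      by (intro real_vector.span_add real_vector.span_scale) (auto intro: real_vector.span_base)
    then show ?thesis by simp
  qed
qed


section \<open>Polynomial functions\<close>

lemma sum_fun_apply: "(\<Sum>i\<in>I. f i) x = (\<Sum>i\<in>I. f i x)"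
  by (induction I rule: infinite_finite_induct) auto

lemma prod_fun_apply: "(\<Prod>i\<in>I. f i) x = (\<Prod>i\<in>I. f i x)"
  by (induction I rule: infinite_finite_induct) auto

lemma linear_mult_left_fun:
  fixes l :: "'a \<Rightarrow> real"
  shows "linear (\<lambda>f. l * f)"
  by (auto simp: linear_iff fun_eq_iff algebra_simps)

lemma subspace_sym_power: "subspace (sym_power k)"
  unfolding sym_power_def by simp

lemma subspace_sym_algebra: "subspace sym_algebra"
  unfolding sym_algebra_def by simp

lemma sym_power_subset: "sym_power k \<subseteq> sym_algebra"
  unfolding sym_algebra_def using real_vector.span_superset by blast

lemma one_in_sym_power: "1 \<in> sym_power 0"
  unfolding sym_power_def by (rule real_vector.span_base) simp

lemma linear_mult_sym_power:
  assumes l: "linear l" and f: "f \<in> sym_power k"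
  shows "l * f \<in> sym_power (Suc k)"
proof -
  let ?G = "\<lambda>k. {\<Prod>i<k. l i | l. \<forall>i<k. linear (l i :: 'a \<Rightarrow> real)}"
  have "(\<lambda>f. l * f) ` ?G k \<subseteq> ?G (Suc k)"
  proof clarify
    fix a :: "nat \<Rightarrow> 'a \<Rightarrow> real" assume a: "\<forall>i<k. linear (a i)"
    show "\<exists>b. l * (\<Prod>i<k. a i) = (\<Prod>i<Suc k. b i) \<and> (\<forall>i<Suc k. linear (b i))"
      using a l by (intro exI[of _ "a(k := l)"]) (auto simp: less_Suc_eq mult.commute)
  qed
  then have "(\<lambda>f. l * f) ` span (?G k) \<subseteq> span (?G (Suc k))"
    unfolding linear_span_image[OF linear_mult_left_fun, symmetric] by (rule real_vector.span_mono)
  with f show ?thesis unfolding sym_power_def by blast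
qed

text \<open>The elements satisfying \<open>P\<close> form a subspace containing all products of
  linear forms, which are built from 1 by multiplying with one form at a time. This avoids handling
  degrees in the proofs about single polynomials.\<close>

lemma sym_algebra_induct [consumes 1, case_names one scale add mult]:
  assumes f: "f \<in> sym_algebra"
    and one: "P 1"
    and scale: "\<And>c f. f \<in> sym_algebra \<Longrightarrow> P f \<Longrightarrow> P (c *\<^sub>R f)"
    and add: "\<And>f g. f \<in> sym_algebra \<Longrightarrow> g \<in> sym_algebra \<Longrightarrow> P f \<Longrightarrow> P g \<Longrightarrow> P (f + g)"
    and mult: "\<And>l f. linear l \<Longrightarrow> f \<in> sym_algebra \<Longrightarrow> P f \<Longrightarrow> P (l * f)"
  shows "P f"
proof -
  let ?Q = "{f \<in> sym_algebra. P f}"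
  have "P (0 *\<^sub>R 1)"
    using scale[of 1 0] one one_in_sym_power sym_power_subset by blast
  then have sub: "subspace ?Q"
    using subspace_sym_algebra scale add by (auto simp: real_vector.subspace_def)
  have prods: "(\<Prod>i<k. l i) \<in> ?Q" if "\<forall>i<k. linear (l i)" for k and l :: "nat \<Rightarrow> 'a \<Rightarrow> real"
    using that
  proof (induction k)
    case 0
    then show ?case
      using one one_in_sym_power sym_power_subset by (auto simp del: one_fun_apply)
  next
    case (Suc k)
    then have "(\<Prod>i<k. l i) \<in> ?Q" by simp
    moreover have "(\<Prod>i<Suc k. l i) \<in> sym_algebra"
      using Suc.prems unfolding sym_power_def
      by (intro subsetD[OF sym_power_subset[of "Suc k", unfolded sym_power_def]] real_vector.span_base)
        blast
    ultimately show ?case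
      using mult[of "l k" "\<Prod>i<k. l i"] Suc.prems
      by (simp add: mult.commute del: times_fun_apply)
  qed
  have "sym_power k \<subseteq> ?Q" for k
    unfolding sym_power_def using prods by (intro real_vector.span_minimal[OF _ sub]) blast
  then have "span (\<Union>k. sym_power k) \<subseteq> ?Q"
    by (intro real_vector.span_minimal[OF _ sub]) blast
  then have "sym_algebra \<subseteq> ?Q" by (simp only: sym_algebra_def[symmetric])
  with f show ?thesis by blast
qed

lemma linear_mult_sym_algebra:
  assumes "f \<in> sym_algebra" "linear l"
  shows "l * f \<in> sym_algebra"
proof -
  have "(\<lambda>f. l * f) ` (\<Union>k. sym_power k) \<subseteq> (\<Union>k. sym_power k)"
    using linear_mult_sym_power[OF assms(2)] by blast
  then have "(\<lambda>f. l * f) ` sym_algebra \<subseteq> sym_algebra"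
    unfolding sym_algebra_def linear_span_image[OF linear_mult_left_fun, symmetric]
    by (rule real_vector.span_mono)
  with assms(1) show ?thesis by blast
qed

lemma prod_mult_sym_power:
  assumes "finite I" "\<forall>i\<in>I. linear (a i)" "f \<in> sym_power k"
  shows "(\<Prod>i\<in>I. a i) * f \<in> sym_power (card I + k)"
  using assms
proof (induction I rule: finite_induct)
  case (insert j I)
  then show ?case
    using linear_mult_sym_power[of "a j" "(\<Prod>i\<in>I. a i) * f" "card I + k"]
    by (simp add: mult.assoc del: times_fun_apply)
qed simp

lemma prod_mult_sym_algebra:
  assumes "finite I" "\<forall>i\<in>I. linear (a i)" "f \<in> sym_algebra"
  shows "(\<Prod>i\<in>I. a i) * f \<in> sym_algebra"
  using assms
proof (induction I rule: finite_induct)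
  case (insert j I)
  then show ?case
    using linear_mult_sym_algebra[of "(\<Prod>i\<in>I. a i) * f" "a j"]
    by (simp add: mult.assoc del: times_fun_apply)
qed simp

section \<open>Homogeneity, continuity on lines and homogeneous components\<close>

lemma sym_power_homogeneous:
  assumes "f \<in> sym_power k"
  shows "f (t *\<^sub>R x) = t ^ k * f x"
proof -
  have "subspace {f :: 'a \<Rightarrow> real. f (t *\<^sub>R x) = t ^ k * f x}"
    by (auto simp: real_vector.subspace_def algebra_simps)
  moreover have "{\<Prod>i<k. l i | l. \<forall>i<k. linear (l i)} \<subseteq> {f :: 'a \<Rightarrow> real. f (t *\<^sub>R x) = t ^ k * f x}"
    by (auto simp: prod_fun_apply linear_cmul prod.distrib)
  ultimately show ?thesis
    using assms real_vector.span_minimal unfolding sym_power_def by blast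
qed

text \<open>Continuity along lines is a statement about a real parameter, so it makes sense for a
  domain without topology, and it is all that the limit arguments use.\<close>

lemma continuous_on_line:
  fixes f :: "'g::real_vector \<Rightarrow> real"
  assumes "f \<in> sym_algebra"
  shows "continuous_on UNIV (\<lambda>t. f (x + t *\<^sub>R w))"
  using assms
proof (induction f rule: sym_algebra_induct)
  case (mult l f)
  then show ?case by (auto simp: linear_add linear_cmul intro!: continuous_intros)
qed (auto intro!: continuous_intros)

text \<open>Requiring \<open>c k = 0\<close> beyond \<open>N\<close> allows two decompositions to be
  added over a common range.\<close>

lemma sym_algebra_decompose:
  assumes "f \<in> sym_algebra"
  shows "\<exists>N c. (\<forall>k. c k \<in> sym_power k) \<and> (\<forall>k>N. c k = 0) \<and> f = (\<Sum>k\<le>N. c k)"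
  using assms
proof (induction f rule: sym_algebra_induct)
  case one
  show ?case
    using one_in_sym_power real_vector.subspace_0[OF subspace_sym_power]
    by (intro exI[of _ 0] exI[of _ "\<lambda>k. if k = 0 then 1 else 0"]) auto
next
  case (scale r f)
  then obtain N c where "\<forall>k. c k \<in> sym_power k" "\<forall>k>N. c k = 0" "f = (\<Sum>k\<le>N. c k)" by blast
  then show ?case
    by (intro exI[of _ N] exI[of _ "\<lambda>k. r *\<^sub>R c k"])
      (auto simp: scaleR_sum_right simp del: scaleR_fun_apply
        intro: real_vector.subspace_scale[OF subspace_sym_power])
next
  case (add f g)
  then obtain N c N' c' where c: "\<forall>k. c k \<in> sym_power k" "\<forall>k>N. c k = 0" "f = (\<Sum>k\<le>N. c k)"
    and c': "\<forall>k. c' k \<in> sym_power k" "\<forall>k>N'. c' k = 0" "g = (\<Sum>k\<le>N'. c' k)" by blast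
  have "f = (\<Sum>k\<le>max N N'. c k)"
    unfolding c(3) using c(2) by (intro sum.mono_neutral_left) auto
  moreover have "g = (\<Sum>k\<le>max N N'. c' k)"
    unfolding c'(3) using c'(2) by (intro sum.mono_neutral_left) auto
  ultimately have "f + g = (\<Sum>k\<le>max N N'. c k + c' k)" by (simp add: sum.distrib)
  then show ?case
    using c(1,2) c'(1,2)
    by (intro exI[of _ "max N N'"] exI[of _ "\<lambda>k. c k + c' k"])
      (auto intro: real_vector.subspace_add[OF subspace_sym_power] simp del: plus_fun_apply)
next
  case (mult l f)
  then obtain N c where c: "\<forall>k. c k \<in> sym_power k" "\<forall>k>N. c k = 0" "f = (\<Sum>k\<le>N. c k)" by blast
  let ?c = "\<lambda>k. case k of 0 \<Rightarrow> 0 | Suc j \<Rightarrow> l * c j"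
  have "l * f = (\<Sum>k\<le>Suc N. ?c k)"
    unfolding sum.atMost_Suc_shift c(3) by (simp add: sum_distrib_left)
  moreover have "\<forall>k. ?c k \<in> sym_power k"
    using c(1) mult(1) linear_mult_sym_power real_vector.subspace_0[OF subspace_sym_power]
    by (auto split: nat.split)
  moreover have "\<forall>k>Suc N. ?c k = 0"
    using c(2) by (auto split: nat.split simp: fun_eq_iff)
  ultimately show ?case by blast
qed

text \<open>The pointwise form is deliberate: interpolants are known to scale correctly only on
  certain hyperplanes, and quotients only where the divisor is nonzero. On such a ray the degree
  \<open>m\<close> part must account for the whole value.\<close>

lemma homogeneous_component:
  assumes "f \<in> sym_algebra"
  shows "\<exists>g\<in>sym_power m. \<forall>x. (\<forall>t>0. f (t *\<^sub>R x) = t ^ m * f x) \<longrightarrow> g x = f x"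
proof -
  obtain N c where c: "\<And>k. c k \<in> sym_power k" "\<And>k. k > N \<Longrightarrow> c k = 0" "f = (\<Sum>k\<le>N. c k)"
    using sym_algebra_decompose[OF assms] by blast
  have "c m x = f x" if x: "\<forall>t>0. f (t *\<^sub>R x) = t ^ m * f x" for x
  proof -
    let ?b = "\<lambda>k. c k x - (if k = m then f x else 0)"
    let ?n = "max N m"
    have fn: "f = (\<Sum>k\<le>?n. c k)"
      unfolding c(3) using c(2) by (intro sum.mono_neutral_left) auto
    have "(\<Sum>k\<le>?n. ?b k * t ^ k) = 0" if "t > 0" for t
    proof -
      have "f (t *\<^sub>R x) = (\<Sum>k\<le>?n. c k x * t ^ k)"
        using fn sym_power_homogeneous[OF c(1)] by (simp add: sum_fun_apply mult.commute)
      moreover have "(\<Sum>k\<le>?n. (if k = m then f x else 0) * t ^ k) = f x * t ^ m"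
        by (subst sum.cong[of _ _ _ "\<lambda>k. if k = m then f x * t ^ m else 0"]) auto
      ultimately show ?thesis
        using x that by (simp add: algebra_simps sum_subtractf)
    qed
    then have "{0<..} \<subseteq> {t. (\<Sum>k\<le>?n. ?b k * t ^ k) = 0}" by auto
    then have "infinite {t. (\<Sum>k\<le>?n. ?b k * t ^ k) = 0}"
      using infinite_Ioi[of "0::real"] finite_subset by blast
    \<comment> \<open>A real polynomial in \<open>t\<close> with infinitely many zeros has zero
      coefficients; the one of degree \<open>m\<close> is \<open>c m x - f x\<close>.\<close>
    then have "?b m = 0"
      using polyfun_rootbound[of ?b m ?n] by (metis max.cobounded2)
    then show ?thesis by simp
  qed
  with c(1) show ?thesis by blast
qed

text \<open>The coordinate functions of a finite basis span the dual, so multiplying a finite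
  spanning set for products of \<open>k\<close> forms by them gives one for products of
  \<open>k + 1\<close> forms.\<close>

lemma finite_dim_sym_power:
  assumes "finite_dim (UNIV :: 'g::real_vector set)"
  shows "finite_dim (sym_power k :: ('g \<Rightarrow> real) set)"
proof -
  obtain B :: "'g set" where B: "independent B" "UNIV \<subseteq> span B" "finite B"
    using finite_dim_basis[OF assms] by metis
  define C where "C = (\<lambda>b x. real_vector.representation B x b) ` B"
  have l_span: "l \<in> span C" if "linear l" for l :: "'g \<Rightarrow> real"
  proof -
    have l: "l x = (\<Sum>b\<in>B. real_vector.representation B x b * l b)" for x
    proof -
      have "x = (\<Sum>b\<in>B. real_vector.representation B x b *\<^sub>R b)"
        using B by (intro real_vector.sum_representation_eq[symmetric]) auto
      then have "l x = l (\<Sum>b\<in>B. real_vector.representation B x b *\<^sub>R b)" by simp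
      then show ?thesis using that by (simp add: linear_sum linear_cmul)
    qed
    have "l = (\<Sum>b\<in>B. l b *\<^sub>R (\<lambda>x. real_vector.representation B x b))"
      by (rule ext, subst l) (simp add: sum_fun_apply mult.commute)
    also have "\<dots> \<in> span C"
      unfolding C_def by (intro real_vector.span_sum real_vector.span_scale real_vector.span_base) auto
    finally show ?thesis .
  qed
  have "\<exists>F. finite F \<and> (\<forall>l :: nat \<Rightarrow> 'g \<Rightarrow> real. (\<forall>i<k. linear (l i)) \<longrightarrow> (\<Prod>i<k. l i) \<in> span F)"
  proof (induction k)
    case 0
    then show ?case
      by (intro exI[of _ "{1}"]) (auto intro: real_vector.span_base simp del: one_fun_apply)
  next
    case (Suc k)
    then obtain F where F: "finite F"
      "\<And>l :: nat \<Rightarrow> 'g \<Rightarrow> real. (\<forall>i<k. linear (l i)) \<Longrightarrow> (\<Prod>i<k. l i) \<in> span F" by blast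
    let ?F = "(\<lambda>(c, f). c * f) ` (C \<times> F)"
    have 1: "c * g \<in> span ?F" if "c \<in> C" "g \<in> span F" for c g
    proof -
      have "c * g \<in> span ((\<lambda>f. c * f) ` F)"
        using linear_span_image[OF linear_mult_left_fun[of c], of F] that(2) by blast
      moreover have "(\<lambda>f. c * f) ` F \<subseteq> ?F" using that(1) by auto
      ultimately show ?thesis using real_vector.span_mono by blast
    qed
    have 2: "l * g \<in> span ?F" if "l \<in> span C" "g \<in> span F" for l g
    proof -
      have "(\<lambda>c. g * c) ` C \<subseteq> span ?F" using 1 that(2) by (auto simp: mult.commute)
      then have "(\<lambda>c. g * c) ` span C \<subseteq> span ?F"
        using linear_span_image[OF linear_mult_left_fun[of g], of C] real_vector.span_minimal
        by (metis real_vector.subspace_span)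
      then show ?thesis using that(1) by (auto simp: mult.commute)
    qed
    have "finite ?F" using F(1) B(3) by (simp add: C_def)
    moreover have "(\<Prod>i<Suc k. l i) \<in> span ?F" if "\<forall>i<Suc k. linear (l i)" for l :: "nat \<Rightarrow> 'g \<Rightarrow> real"
      using 2[OF l_span F(2), of "l k" l] that by (simp add: mult.commute)
    ultimately show ?case by blast
  qed
  then obtain F where "finite F"
    "{\<Prod>i<k. l i | l. \<forall>i<k. linear (l i :: 'g \<Rightarrow> real)} \<subseteq> span F" by blast
  then show ?thesis
    unfolding finite_dim_def sym_power_def
    by (intro exI[of _ F]) (auto dest: real_vector.span_minimal)
qed

section \<open>Cancellation of linear forms and divisibility on a subspace\<close>

lemma vanish_of_linear_mult:
  assumes "subspace W" "linear a" "w \<in> W" "a w \<noteq> 0" "u \<in> sym_algebra"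
    and "\<And>x. x \<in> W \<Longrightarrow> a x * u x = 0" and x: "x \<in> W"
  shows "u x = 0"
proof (cases "a x = 0")
  case True
  \<comment> \<open>At a point of the kernel of \<open>a\<close> one cannot divide. The points
    \<open>x + t *\<^sub>R w\<close> with \<open>t\<close> nonzero lie in \<open>W\<close> and off
    the kernel, and \<open>u x\<close> is the limit of the zero values there.\<close>
  have "continuous_on UNIV (\<lambda>t. u (x + t *\<^sub>R w))"
    by (rule continuous_on_line[OF assms(5)])
  then have "((\<lambda>t. u (x + t *\<^sub>R w)) \<longlongrightarrow> u (x + 0 *\<^sub>R w)) (at 0)"
    unfolding continuous_on_def by (metis UNIV_I)
  moreover have "u (x + t *\<^sub>R w) = 0" if "t \<noteq> 0" for t
  proof -
    have "x + t *\<^sub>R w \<in> W"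
      using assms(1,3) x by (simp add: real_vector.subspace_add real_vector.subspace_scale)
    moreover have "a (x + t *\<^sub>R w) \<noteq> 0"
      using True that assms(2,4) by (simp add: linear_add linear_cmul)
    ultimately show ?thesis using assms(6) by fastforce
  qed
  then have "((\<lambda>t. u (x + t *\<^sub>R w)) \<longlongrightarrow> 0) (at 0)"
    by (intro tendsto_eventually) (auto simp: eventually_at_filter)
  ultimately show ?thesis
    using tendsto_unique[of "at (0::real)" "\<lambda>t. u (x + t *\<^sub>R w)" "u x" 0] by simp
next
  case False
  then show ?thesis using assms(6)[OF x] by simp
qed

lemma vanish_of_prod_mult:
  assumes "finite I" "subspace W" "u \<in> sym_algebra"
    and "\<And>i. i \<in> I \<Longrightarrow> linear (a i)"
    and "\<And>i. i \<in> I \<Longrightarrow> \<exists>w\<in>W. a i w \<noteq> 0"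
    and "\<And>x. x \<in> W \<Longrightarrow> (\<Prod>i\<in>I. a i x) * u x = 0" and "x \<in> W"
  shows "u x = 0"
  using assms
proof (induction I arbitrary: x rule: finite_induct)
  case (insert k I)
  obtain w where w: "w \<in> W" "a k w \<noteq> 0" using insert.prems(4) by blast
  have k: "linear (a k)" using insert.prems(3) by blast
  have inS: "(\<Prod>i\<in>I. a i) * u \<in> sym_algebra"
    using insert.prems insert.hyps by (intro prod_mult_sym_algebra) auto
  have "((\<Prod>i\<in>I. a i) * u) y = 0" if "y \<in> W" for y
  proof (rule vanish_of_linear_mult[OF insert.prems(1) k w inS _ that])
    fix z assume "z \<in> W"
    from insert.prems(5)[OF this] show "a k z * ((\<Prod>i\<in>I. a i) * u) z = 0"
      using insert.hyps by (simp add: prod_fun_apply mult.assoc)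
  qed
  then have "(\<Prod>i\<in>I. a i y) * u y = 0" if "y \<in> W" for y
    using that by (simp add: prod_fun_apply)
  then show ?case
    using insert.prems by (intro insert.IH) auto
qed auto

text \<open>When \<open>a v = 1\<close>, the shifted point is the projection of \<open>x\<close> to
  the kernel of \<open>a\<close> along \<open>v\<close>, and this is a remainder theorem. The
  induction rests on a discrete product rule: multiplying \<open>f\<close> by \<open>l\<close>
  replaces the quotient \<open>q\<close> by
  \<open>(l - l v *\<^sub>R a) * q + l v *\<^sub>R f\<close>.\<close>

lemma diff_projection_dvd:
  assumes "h \<in> sym_algebra" and a: "linear a"
  shows "\<exists>q\<in>sym_algebra. \<forall>x. h x - h (x - a x *\<^sub>R v) = a x * q x"
  using assms(1)
proof (induction h rule: sym_algebra_induct)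
  case one
  show ?case
    using real_vector.subspace_0[OF subspace_sym_algebra] by (intro bexI[of _ 0]) auto
next
  case (scale c f)
  then obtain q where q: "q \<in> sym_algebra" "\<And>x. f x - f (x - a x *\<^sub>R v) = a x * q x" by blast
  have "(c *\<^sub>R f) x - (c *\<^sub>R f) (x - a x *\<^sub>R v) = a x * (c *\<^sub>R q) x" for x
    using q(2)[of x] by (simp add: right_diff_distrib[symmetric])
  then show ?case
    using q(1) real_vector.subspace_scale[OF subspace_sym_algebra] by blast
next
  case (add f g)
  then obtain q r where q: "q \<in> sym_algebra" "\<And>x. f x - f (x - a x *\<^sub>R v) = a x * q x"
    and r: "r \<in> sym_algebra" "\<And>x. g x - g (x - a x *\<^sub>R v) = a x * r x" by blast
  have "(f + g) x - (f + g) (x - a x *\<^sub>R v) = a x * (q + r) x" for x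
    using q(2)[of x] r(2)[of x] by (simp add: algebra_simps)
  then show ?case
    using q(1) r(1) real_vector.subspace_add[OF subspace_sym_algebra] by blast
next
  case (mult l f)
  then obtain q where q: "q \<in> sym_algebra" "\<And>x. f x - f (x - a x *\<^sub>R v) = a x * q x" by blast
  let ?l = "l - l v *\<^sub>R a"
  have "linear ?l" using mult(1) a by (auto simp: linear_iff algebra_simps)
  then have "?l * q + l v *\<^sub>R f \<in> sym_algebra"
    using q(1) mult(2)
    by (intro real_vector.subspace_add[OF subspace_sym_algebra]
        real_vector.subspace_scale[OF subspace_sym_algebra] linear_mult_sym_algebra)
  moreover have "(l * f) x - (l * f) (x - a x *\<^sub>R v) = a x * (?l * q + l v *\<^sub>R f) x" for x
  proof -
    have "(l * f) x - (l * f) (x - a x *\<^sub>R v)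
        = a x * l v * f x + (l x - a x * l v) * (f x - f (x - a x *\<^sub>R v))"
      using mult(1) by (simp add: linear_diff linear_cmul algebra_simps)
    then show ?thesis by (simp only: q(2)) (simp add: algebra_simps)
  qed
  ultimately show ?case by blast
qed

text \<open>Working relative to \<open>W\<close> serves the interpolation, which divides on a
  hyperplane. The quotient is still a polynomial on the whole space, so no polynomial functions on
  \<open>W\<close> have to be introduced.\<close>

lemma linear_dvd_on:
  assumes W: "subspace W" "v \<in> W" and a: "linear a" "a v \<noteq> 0" and h: "h \<in> sym_algebra"
    and van: "\<And>x. x \<in> W \<Longrightarrow> a x = 0 \<Longrightarrow> h x = 0"
  shows "\<exists>q\<in>sym_algebra. \<forall>x\<in>W. h x = a x * q x"
proof -
  \<comment> \<open>Normalised so that \<open>a\<close> takes the value 1; then the shifted point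
    lies in \<open>W\<close> and in the kernel of \<open>a\<close>, where \<open>h\<close>
    vanishes.\<close>
  let ?v = "(1 / a v) *\<^sub>R v"
  obtain q where q: "q \<in> sym_algebra" "\<And>x. h x - h (x - a x *\<^sub>R ?v) = a x * q x"
    using diff_projection_dvd[OF h a(1), of ?v] by blast
  have "h (x - a x *\<^sub>R ?v) = 0" if "x \<in> W" for x
    using that W a
    by (intro van) (auto simp: linear_diff linear_cmul real_vector.subspace_diff real_vector.subspace_scale)
  with q show ?thesis by (intro bexI[OF _ q(1)]) (metis diff_0_right)
qed

text \<open>This is coprimality of pairwise non-proportional forms on \<open>W\<close>. After
  division by the other factors, the quotient must vanish on the kernel of \<open>a j\<close> in
  \<open>W\<close>, since none of those factors vanishes identically there; so \<open>a j\<close>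
  divides it as well.\<close>

lemma prod_dvd_on:
  assumes "finite I" "subspace W" "h \<in> sym_algebra"
    and "\<And>i. i \<in> I \<Longrightarrow> linear (a i)"
    and "\<And>i. i \<in> I \<Longrightarrow> \<exists>w\<in>W. a i w \<noteq> 0"
    and "\<And>i j. i \<in> I \<Longrightarrow> j \<in> I \<Longrightarrow> i \<noteq> j \<Longrightarrow> \<exists>w\<in>W. a i w \<noteq> 0 \<and> a j w = 0"
    and "\<And>i x. i \<in> I \<Longrightarrow> x \<in> W \<Longrightarrow> a i x = 0 \<Longrightarrow> h x = 0"
  shows "\<exists>q\<in>sym_algebra. \<forall>x\<in>W. h x = (\<Prod>i\<in>I. a i x) * q x"
  using assms
proof (induction I rule: finite_induct)
  case empty
  then show ?case by auto
next
  case (insert j I)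
  have "\<exists>q\<in>sym_algebra. \<forall>x\<in>W. h x = (\<Prod>i\<in>I. a i x) * q x"
  proof (rule insert.IH)
    show "\<exists>w\<in>W. a i w \<noteq> 0 \<and> a j w = 0" if "i \<in> I" "j \<in> I" "i \<noteq> j" for i j
      using that by (intro insert.prems(5)) auto
    show "h x = 0" if "i \<in> I" "x \<in> W" "a i x = 0" for i x
      using that by (intro insert.prems(6)[of i]) auto
  qed (use insert.prems(1-4) in auto)
  then obtain q where q: "q \<in> sym_algebra" "\<And>x. x \<in> W \<Longrightarrow> h x = (\<Prod>i\<in>I. a i x) * q x"
    by blast
  have aj: "linear (a j)" using insert.prems by blast
  let ?W = "W \<inter> {x. a j x = 0}"
  have W': "subspace ?W"
    using insert.prems(1) aj by (intro real_vector.subspace_inter linear_subspace_kernel)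
  have "q x = 0" if "x \<in> W" "a j x = 0" for x
  proof (rule vanish_of_prod_mult[OF insert.hyps(1) W' q(1)])
    show "\<exists>w\<in>?W. a i w \<noteq> 0" if "i \<in> I" for i
      using insert.prems(5)[of i j] insert.hyps(2) that by auto
    show "(\<Prod>i\<in>I. a i y) * q y = 0" if "y \<in> ?W" for y
      using q(2)[of y] insert.prems(6)[of j y] that by auto
    show "x \<in> ?W" using that by simp
  qed (rule insert.prems(3), rule insertI2)
  moreover obtain v where v: "v \<in> W" "a j v \<noteq> 0"
    using insert.prems(4)[OF insertI1] by blast
  ultimately obtain r where r: "r \<in> sym_algebra" "\<forall>x\<in>W. q x = a j x * r x"
    using linear_dvd_on[OF insert.prems(1) v(1) aj v(2) q(1)] by blast
  then show ?case
    using q(2) insert.hyps by (intro bexI[of _ r]) auto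
qed

text \<open>
  Adding the condition on the kernel of \<open>a r\<close>: the discrepancy there vanishes on the
  intersections with the other kernels. By 3-independence the restrictions of the other \<open>a i\<close> to
  the kernel of \<open>a r\<close> are pairwise coprime, so the discrepancy is divisible by their product, and
  the correction can be chosen to vanish on the other kernels.
\<close>

lemma interpolation:
  fixes a f :: "'i \<Rightarrow> 'g::real_vector \<Rightarrow> real"
  assumes "finite I"
    and "\<And>i. i \<in> I \<Longrightarrow> linear (a i)"
    and "\<And>i j. i \<in> I \<Longrightarrow> j \<in> I \<Longrightarrow> i \<noteq> j \<Longrightarrow> \<exists>w. a i w \<noteq> 0 \<and> a j w = 0"
    and "\<And>i j k. i \<in> I \<Longrightarrow> j \<in> I \<Longrightarrow> k \<in> I \<Longrightarrow> i \<noteq> j \<Longrightarrow> i \<noteq> k \<Longrightarrow> j \<noteq> k \<Longrightarrow>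
           \<exists>w. a i w \<noteq> 0 \<and> a j w = 0 \<and> a k w = 0"
    and "\<And>i. i \<in> I \<Longrightarrow> f i \<in> sym_algebra"
    and "\<And>i j x. i \<in> I \<Longrightarrow> j \<in> I \<Longrightarrow> a i x = 0 \<Longrightarrow> a j x = 0 \<Longrightarrow> f i x = f j x"
  shows "\<exists>g\<in>sym_algebra. \<forall>i\<in>I. \<forall>x. a i x = 0 \<longrightarrow> g x = f i x"
  using assms
proof (induction I rule: finite_induct)
  case empty
  then show ?case using one_in_sym_power sym_power_subset by auto
next
  case (insert r I)
  have "\<exists>g\<in>sym_algebra. \<forall>i\<in>I. \<forall>x. a i x = 0 \<longrightarrow> g x = f i x"
  proof (rule insert.IH)
    show "\<exists>w. a i w \<noteq> 0 \<and> a j w = 0 \<and> a k w = 0"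
      if "i \<in> I" "j \<in> I" "k \<in> I" "i \<noteq> j" "i \<noteq> k" "j \<noteq> k" for i j k
      using that by (intro insert.prems(3)) auto
  qed (use insert.prems in auto)
  then obtain g where g: "g \<in> sym_algebra" "\<And>i x. i \<in> I \<Longrightarrow> a i x = 0 \<Longrightarrow> g x = f i x" by blast
  let ?W = "{x. a r x = 0}"
  have W: "subspace ?W" using insert.prems(1) by (intro linear_subspace_kernel) auto
  have "\<exists>q\<in>sym_algebra. \<forall>x\<in>?W. (f r - g) x = (\<Prod>i\<in>I. a i x) * q x"
  proof (rule prod_dvd_on[OF insert.hyps(1) W])
    show "f r - g \<in> sym_algebra"
      using g(1) insert.prems(4) by (simp add: real_vector.subspace_diff[OF subspace_sym_algebra])
    show "\<exists>w\<in>?W. a i w \<noteq> 0" if "i \<in> I" for i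
      using insert.prems(2)[of i r] that insert.hyps by auto
    show "\<exists>w\<in>?W. a i w \<noteq> 0 \<and> a j w = 0" if "i \<in> I" "j \<in> I" "i \<noteq> j" for i j
    proof -
      have "\<exists>w. a i w \<noteq> 0 \<and> a j w = 0 \<and> a r w = 0"
        using that insert.hyps(2) by (intro insert.prems(3)) auto
      then show ?thesis by blast
    qed
    show "(f r - g) x = 0" if "i \<in> I" "x \<in> ?W" "a i x = 0" for i x
      using insert.prems(5)[of r i x] g(2)[of i x] that by auto
  qed (use insert.prems in auto)
  then obtain q where q: "q \<in> sym_algebra" "\<And>x. a r x = 0 \<Longrightarrow> f r x - g x = (\<Prod>i\<in>I. a i x) * q x"
    by auto
  let ?g = "g + (\<Prod>i\<in>I. a i) * q"
  have "?g \<in> sym_algebra"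
    using g(1) q(1) insert.prems(1) insert.hyps(1)
    by (intro real_vector.subspace_add[OF subspace_sym_algebra] prod_mult_sym_algebra) auto
  moreover have "?g x = f r x" if "a r x = 0" for x
    using q(2)[OF that] by (simp add: prod_fun_apply)
  moreover have "?g x = f i x" if "i \<in> I" "a i x = 0" for i x
    using g(2)[OF that] that insert.hyps(1) by (auto simp: prod_fun_apply)
  ultimately show ?case by blast
qed


section \<open>Invariance of the index counts\<close>

text \<open>The functionals in \<open>F\<close> are treated one at a time. A small positive step
  along a direction on which \<open>\<phi>\<close> is nonzero leaves its kernel, and it keeps the
  finitely many strict signs already achieved.\<close>

lemma perturb_off_kernels:
  fixes y :: "'g::real_vector"
  assumes "finite F" "finite A" "\<forall>a\<in>A. linear a" "\<forall>\<phi>\<in>F. linear \<phi>" "\<forall>\<phi>\<in>F. \<exists>v. \<phi> v \<noteq> 0"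
  shows "\<exists>y'. (\<forall>a\<in>A. a y \<noteq> 0 \<longrightarrow> a y * a y' > (0::real)) \<and> (\<forall>\<phi>\<in>F. \<phi> y' \<noteq> (0::real))"
  using assms
proof (induction F rule: finite_induct)
  case empty
  then show ?case by (auto simp: zero_less_mult_iff intro!: exI[of _ y])
next
  case (insert \<phi> F)
  then obtain z where z: "\<forall>a\<in>A. a y \<noteq> 0 \<longrightarrow> a y * a z > 0" "\<forall>\<psi>\<in>F. \<psi> z \<noteq> 0" by auto
  obtain v where v: "\<phi> v \<noteq> 0" using insert.prems by auto
  define w where "w = (if \<phi> z = 0 then v else 0)"
  have lin: "\<forall>a\<in>A \<union> F. linear a" using insert.prems by auto
  have "\<forall>a\<in>A \<union> F. a z \<noteq> 0 \<longrightarrow> (\<forall>\<^sub>F s in at_right 0. a z * a (z + s *\<^sub>R w) > 0)"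
  proof (intro ballI impI)
    fix a assume a: "a \<in> A \<union> F" "a z \<noteq> 0"
    have "((\<lambda>s. a z * (a z + s * a w)) \<longlongrightarrow> a z * (a z + 0 * a w)) (at_right 0)"
      by (intro tendsto_intros)
    moreover have "a z * (a z + 0 * a w) > 0"
      using a(2) by (simp add: zero_less_mult_iff linorder_neq_iff disj_commute)
    ultimately have "\<forall>\<^sub>F s in at_right 0. a z * (a z + s * a w) > 0"
      by (rule order_tendstoD)
    then show "\<forall>\<^sub>F s in at_right 0. a z * a (z + s *\<^sub>R w) > 0"
      using lin a(1) by (simp add: linear_add linear_cmul)
  qed
  then have "\<forall>\<^sub>F s in at_right 0. \<forall>a\<in>A \<union> F. a z \<noteq> 0 \<longrightarrow> a z * a (z + s *\<^sub>R w) > 0"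
    using insert.hyps insert.prems by (intro eventually_ball_finite) (auto intro: eventually_mono)
  moreover have "\<forall>\<^sub>F s in at_right (0::real). s > 0"
    by (rule eventually_at_right_less)
  ultimately have "\<forall>\<^sub>F s in at_right 0. (\<forall>a\<in>A \<union> F. a z \<noteq> 0 \<longrightarrow> a z * a (z + s *\<^sub>R w) > 0) \<and> s > 0"
    by (rule eventually_conj)
  then obtain s where s: "\<forall>a\<in>A \<union> F. a z \<noteq> 0 \<longrightarrow> a z * a (z + s *\<^sub>R w) > 0" "s > 0"
    using eventually_happens' trivial_limit_at_right_real by (metis (mono_tags, lifting))
  have "a y * a (z + s *\<^sub>R w) > 0" if "a \<in> A" "a y \<noteq> 0" for a
  proof -
    have yz: "a y * a z > 0" using z(1) that by blast
    then have "a z \<noteq> 0" by auto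
    then have "a z * a (z + s *\<^sub>R w) > 0" using s(1) that(1) by blast
    with yz show ?thesis by (auto simp: zero_less_mult_iff)
  qed
  moreover have "\<psi> (z + s *\<^sub>R w) \<noteq> 0" if "\<psi> \<in> insert \<phi> F" for \<psi>
  proof (cases "\<psi> = \<phi>")
    case True
    have "linear \<phi>" using insert.prems by blast
    then show ?thesis using v s(2) True
      by (auto simp: w_def linear_add linear_cmul linear_0)
  next
    case False
    then have "\<psi> \<in> F" using that by blast
    with z(2) s(1) have "\<psi> z * \<psi> (z + s *\<^sub>R w) > 0" by blast
    then show ?thesis by auto
  qed
  ultimately show ?case by blast
qed

text \<open>
  The data of a one-skeleton without a common valence. Unlike \<^locale>\<open>abstract_one_skeleton\<close>,
  it passes to the components of the subgraphs \<open>\<Gamma>\<^sub>h\<close> without comparing valences.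
\<close>

locale axial_graph =
  fixes G :: "('v, 'e) pre_digraph" and arev :: "'e \<Rightarrow> 'e"
    and \<theta> :: "'e \<Rightarrow> 'e \<Rightarrow> 'e" and \<alpha> :: "'e \<Rightarrow> 'g::real_vector \<Rightarrow> real"
  assumes fin_verts: "finite (verts G)" and fin_arcs: "finite (arcs G)"
    and tail_in: "\<And>e. e \<in> arcs G \<Longrightarrow> tail G e \<in> verts G"
    and head_in: "\<And>e. e \<in> arcs G \<Longrightarrow> head G e \<in> verts G"
    and rev_in: "\<And>e. e \<in> arcs G \<Longrightarrow> arev e \<in> arcs G"
    and tail_rev: "\<And>e. e \<in> arcs G \<Longrightarrow> tail G (arev e) = head G e"
    and head_rev: "\<And>e. e \<in> arcs G \<Longrightarrow> head G (arev e) = tail G e"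
    and conn: "\<And>e. e \<in> arcs G \<Longrightarrow>
          bij_betw (\<theta> e) (out_arcs G (tail G e)) (out_arcs G (head G e))"
    and lin: "\<And>e. e \<in> arcs G \<Longrightarrow> linear (\<alpha> e)"
    and not_parallel: "\<And>e e' c. e \<in> arcs G \<Longrightarrow> e' \<in> arcs G \<Longrightarrow> tail G e = tail G e' \<Longrightarrow>
          e \<noteq> e' \<Longrightarrow> \<alpha> e \<noteq> c *\<^sub>R \<alpha> e'"
    and opposite: "\<And>e. e \<in> arcs G \<Longrightarrow> \<exists>r>0. \<alpha> (arev e) = - (r *\<^sub>R \<alpha> e)"
    and transport: "\<And>e e'. e \<in> arcs G \<Longrightarrow> e' \<in> out_arcs G (tail G e) \<Longrightarrow>
          \<exists>l c. l > 0 \<and> \<alpha> (\<theta> e e') = l *\<^sub>R \<alpha> e' + c *\<^sub>R \<alpha> e"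
begin

text \<open>The vector is explicit here; it stands in for the arbitrary choice inside
  \<open>betti\<close> until independence of the vector is known.\<close>

definition index_count :: "'g \<Rightarrow> nat \<Rightarrow> nat" where
  "index_count x k = card {p \<in> verts G. vertex_index G \<alpha> x p = k}"

lemma index_count_cong:
  assumes "x \<in> polarizing G \<alpha>" "\<forall>e\<in>arcs G. \<alpha> e x * \<alpha> e y > 0"
  shows "index_count x k = index_count y k"
proof -
  have "vertex_index G \<alpha> x p = vertex_index G \<alpha> y p" for p
  proof -
    have "\<alpha> e x < 0 \<longleftrightarrow> \<alpha> e y < 0" if "e \<in> out_arcs G p" for e
      using assms(2) that by (auto simp: zero_less_mult_iff dest!: bspec)
    then show ?thesis
      unfolding vertex_index_def by (metis (no_types, lifting))
  qed
  then show ?thesis unfolding index_count_def by simp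
qed

text \<open>
  Crossing a single wall: the edges whose value changes sign form a matching, and the connection
  along such an edge identifies the signs at one end before the crossing with the signs at the
  other end after it.
\<close>

lemma index_count_wall:
  assumes x: "x \<in> polarizing G \<alpha>" and y: "y \<in> polarizing G \<alpha>"
    and e0: "e0 \<in> arcs G" "\<alpha> e0 x * \<alpha> e0 y < 0"
    and wall: "\<And>e. e \<in> arcs G \<Longrightarrow> \<alpha> e x * \<alpha> e y < 0 \<Longrightarrow> \<exists>c. \<alpha> e = c *\<^sub>R \<alpha> e0"
  shows "index_count x k = index_count y k"
proof -
  \<comment> \<open>By \<open>Z_flip\<close> and \<open>wall\<close> these are exactly the arcs
    whose value changes sign between \<open>x\<close> and \<open>y\<close>.\<close>
  define Z where "Z = {e \<in> arcs G. \<exists>c. \<alpha> e = c *\<^sub>R \<alpha> e0}"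
  have ZA: "e \<in> arcs G" if "e \<in> Z" for e using that by (simp add: Z_def)
  have Z_flip: "\<alpha> e x * \<alpha> e y < 0" if e: "e \<in> Z" for e
  proof -
    obtain c where c: "\<alpha> e = c *\<^sub>R \<alpha> e0" using e by (auto simp: Z_def)
    have "\<alpha> e x \<noteq> 0" using x ZA[OF e] by (auto simp: polarizing_def)
    with c have "c \<noteq> 0" by auto
    then have "c\<^sup>2 * (\<alpha> e0 x * \<alpha> e0 y) < 0" by (intro mult_pos_neg e0(2)) simp
    then show ?thesis using c by (simp add: power2_eq_square algebra_simps)
  qed
  \<comment> \<open>The parameter at which the segment from \<open>x\<close> to \<open>y\<close>
    meets the wall of \<open>e0\<close>; \<open>z\<close> is the point on the wall.\<close>
  define t where "t = \<alpha> e0 x / (\<alpha> e0 x - \<alpha> e0 y)"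
  define z where "z = x + t *\<^sub>R (y - x)"
  have t: "0 < t" "t < 1"
    using e0(2) by (auto simp: t_def field_simps mult_less_0_iff)
  have val: "\<alpha> e z = (1 - t) * \<alpha> e x + t * \<alpha> e y" if "e \<in> arcs G" for e
    using lin[OF that] by (simp add: z_def linear_add linear_cmul linear_diff algebra_simps)
  have "\<alpha> e0 x - \<alpha> e0 y \<noteq> 0" using e0(2) by auto
  then have "t * (\<alpha> e0 x - \<alpha> e0 y) = \<alpha> e0 x" by (simp add: t_def)
  then have "\<alpha> e0 z = 0" using val[OF e0(1)] by (simp add: algebra_simps)
  then have Zz: "\<alpha> e z = 0" if "e \<in> Z" for e using that by (auto simp: Z_def)
  have notZ: "(\<alpha> e z < 0 \<longleftrightarrow> \<alpha> e x < 0) \<and> (\<alpha> e z < 0 \<longleftrightarrow> \<alpha> e y < 0)"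
    if e: "e \<in> arcs G" "e \<notin> Z" for e
  proof -
    have "\<alpha> e x \<noteq> 0" "\<alpha> e y \<noteq> 0" "\<not> \<alpha> e x * \<alpha> e y < 0"
      using x y wall e by (auto simp: polarizing_def Z_def)
    then consider "\<alpha> e x > 0" "\<alpha> e y > 0" | "\<alpha> e x < 0" "\<alpha> e y < 0"
      by (auto simp: mult_less_0_iff linorder_neq_iff)
    then show ?thesis
    proof cases
      case 1
      then have "\<alpha> e z > 0" using val[OF e(1)] t by (simp add: add_pos_pos)
      with 1 show ?thesis by simp
    next
      case 2
      then have "\<alpha> e z < 0" using val[OF e(1)] t by (simp add: add_neg_neg mult_pos_neg)
      with 2 show ?thesis by simp
    qed
  qed
  have uniq: "e = e'" if e: "e \<in> Z" "e' \<in> Z" "tail G e = tail G e'" for e e'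
  proof (rule ccontr)
    assume ne: "e \<noteq> e'"
    obtain c c' where c: "\<alpha> e = c *\<^sub>R \<alpha> e0" "\<alpha> e' = c' *\<^sub>R \<alpha> e0"
      using e by (auto simp: Z_def)
    have "\<alpha> e' x \<noteq> 0" using x ZA e(2) by (auto simp: polarizing_def)
    with c have "c' \<noteq> 0" by auto
    then have "\<alpha> e = (c / c') *\<^sub>R \<alpha> e'" using c by simp
    with not_parallel[OF ZA[OF e(1)] ZA[OF e(2)] e(3) ne] show False by blast
  qed
  have revZ: "arev e \<in> Z" if e: "e \<in> Z" for e
  proof -
    obtain r where "\<alpha> (arev e) = - (r *\<^sub>R \<alpha> e)" using opposite[OF ZA[OF e]] by blast
    moreover obtain c where "\<alpha> e = c *\<^sub>R \<alpha> e0" using e by (auto simp: Z_def)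
    ultimately have "\<alpha> (arev e) = (- r * c) *\<^sub>R \<alpha> e0" by (simp add: scaleR_minus_left)
    then show ?thesis using rev_in[OF ZA[OF e]] unfolding Z_def by blast
  qed
  \<comment> \<open>Swaps the two ends of every arc in \<open>Z\<close> and fixes all other
    vertices. By \<open>uniq\<close> the choice of the arc is forced, and by \<open>revZ\<close> the
    map is an involution.\<close>
  define \<pi> where "\<pi> p = (if \<exists>e\<in>Z. tail G e = p then head G (SOME e. e \<in> Z \<and> tail G e = p) else p)" for p
  have \<pi>_edge: "\<pi> (tail G e) = head G e" if "e \<in> Z" for e
  proof -
    have "(SOME e'. e' \<in> Z \<and> tail G e' = tail G e) = e"
      using that uniq by (intro some_equality) auto
    then show ?thesis using that by (auto simp: \<pi>_def)
  qed
  have \<pi>_fix: "\<pi> p = p" if "\<nexists>e. e \<in> Z \<and> tail G e = p" for p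
    using that by (auto simp: \<pi>_def)
  have \<pi>_verts: "\<pi> p \<in> verts G" if "p \<in> verts G" for p
    using that \<pi>_edge \<pi>_fix ZA head_in by metis
  have \<pi>_inv: "\<pi> (\<pi> p) = p" for p
    using \<pi>_edge \<pi>_fix revZ ZA tail_rev head_rev by metis
  have index: "vertex_index G \<alpha> y (\<pi> p) = vertex_index G \<alpha> x p" for p
  proof (cases "\<exists>e. e \<in> Z \<and> tail G e = p")
    case False
    then have "\<alpha> e x < 0 \<longleftrightarrow> \<alpha> e y < 0" if "e \<in> out_arcs G p" for e
      using notZ[of e] that by auto
    then have "{e \<in> out_arcs G p. \<alpha> e x < 0} = {e \<in> out_arcs G p. \<alpha> e y < 0}" by blast
    then show ?thesis using \<pi>_fix[OF False] by (simp add: vertex_index_def)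
  next
    case True
    then obtain e where e: "e \<in> Z" "tail G e = p" by blast
    have eA: "e \<in> arcs G" by (rule ZA[OF e(1)])
    have bij: "bij_betw (\<theta> e) (out_arcs G p) (out_arcs G (head G e))"
      using conn[OF eA] e(2) by simp
    have "\<alpha> (\<theta> e e') y < 0 \<longleftrightarrow> \<alpha> e' x < 0" if e': "e' \<in> out_arcs G p" for e'
    proof -
      obtain l c where lc: "l > 0" "\<alpha> (\<theta> e e') = l *\<^sub>R \<alpha> e' + c *\<^sub>R \<alpha> e"
        using transport[OF eA] e' e(2) by blast
      obtain c0 where c0: "\<alpha> e = c0 *\<^sub>R \<alpha> e0" using e(1) by (auto simp: Z_def)
      have im: "\<theta> e e' \<in> out_arcs G (head G e)"
        using bij e' bij_betwE by blast
      then have imA: "\<theta> e e' \<in> arcs G" "tail G (\<theta> e e') = head G e" by auto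
      show ?thesis
      proof (cases "e' = e")
        \<comment> \<open>That \<open>\<theta> e\<close> sends \<open>e\<close> to
          \<open>arev e\<close> follows from the axioms: the image is again proportional to
          \<open>e0\<close>, and only one arc of \<open>Z\<close> leaves
          \<open>head G e\<close>.\<close>
        case True
        have "\<alpha> (\<theta> e e') = ((l + c) * c0) *\<^sub>R \<alpha> e0"
          using lc(2) c0 True by (simp add: algebra_simps fun_eq_iff)
        then have "\<theta> e e' \<in> Z" using imA unfolding Z_def by blast
        then have "\<theta> e e' = arev e"
          using uniq revZ[OF e(1)] imA(2) tail_rev[OF eA] by metis
        moreover obtain r where "r > 0" "\<alpha> (arev e) = - (r *\<^sub>R \<alpha> e)"
          using opposite[OF eA] by blast
        ultimately show ?thesis
          using Z_flip[OF e(1)] True by (auto simp: mult_less_0_iff zero_less_mult_iff)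
      next
        case False
        have e'A: "e' \<in> arcs G" using e' by simp
        have "e' \<notin> Z" using uniq[OF _ e(1)] False e' e(2) by auto
        have "\<theta> e e' \<notin> Z"
        proof
          assume "\<theta> e e' \<in> Z"
          then obtain c1 where "\<alpha> (\<theta> e e') = c1 *\<^sub>R \<alpha> e0" by (auto simp: Z_def)
          with lc c0 have "l *\<^sub>R \<alpha> e' = (c1 - c * c0) *\<^sub>R \<alpha> e0"
            by (simp add: algebra_simps fun_eq_iff)
          then have "(1 / l) *\<^sub>R l *\<^sub>R \<alpha> e' = ((1 / l) * (c1 - c * c0)) *\<^sub>R \<alpha> e0" by simp
          then have "\<alpha> e' = ((1 / l) * (c1 - c * c0)) *\<^sub>R \<alpha> e0" using lc(1) by simp
          then have "e' \<in> Z" unfolding Z_def using e'A by blast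
          with \<open>e' \<notin> Z\<close> show False by contradiction
        qed
        \<comment> \<open>At the wall point \<open>z\<close> the term
          \<open>c *\<^sub>R \<alpha> e\<close> vanishes, so transport preserves signs there;
          \<open>notZ\<close> carries them from \<open>z\<close> to either side.\<close>
        then have "\<alpha> (\<theta> e e') y < 0 \<longleftrightarrow> \<alpha> (\<theta> e e') z < 0" using notZ[OF imA(1)] by blast
        also have "\<dots> \<longleftrightarrow> \<alpha> e' z < 0" using lc Zz[OF e(1)] by (simp add: mult_less_0_iff)
        also have "\<dots> \<longleftrightarrow> \<alpha> e' x < 0" using notZ[OF e'A \<open>e' \<notin> Z\<close>] by blast
        finally show ?thesis .
      qed
    qed
    then have "bij_betw (\<theta> e) {e' \<in> out_arcs G p. \<alpha> e' x < 0} {e' \<in> out_arcs G (head G e). \<alpha> e' y < 0}"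
      by (intro bij_betw_Collect[OF bij])
    from bij_betw_same_card[OF this] show ?thesis
      using \<pi>_edge[OF e(1)] e(2) by (simp add: vertex_index_def)
  qed
  have "bij_betw \<pi> {p \<in> verts G. vertex_index G \<alpha> x p = k} {p \<in> verts G. vertex_index G \<alpha> y p = k}"
  proof (rule bij_betw_byWitness[where f' = \<pi>])
    show "\<pi> ` {p \<in> verts G. vertex_index G \<alpha> y p = k} \<subseteq> {p \<in> verts G. vertex_index G \<alpha> x p = k}"
      using \<pi>_verts index[of "\<pi> _"] \<pi>_inv by auto
  qed (use \<pi>_inv \<pi>_verts index in auto)
  then show ?thesis
    unfolding index_count_def by (rule bij_betw_same_card)
qed

text \<open>The hypothesis says that the segment from \<open>x\<close> to \<open>y\<close> crosses
  non-proportional walls at different times. So one wall is crossed at a time, and the number of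
  arcs with different signs at the two ends drops with each crossing.\<close>

lemma index_count_generic:
  assumes "x \<in> polarizing G \<alpha>" "y \<in> polarizing G \<alpha>"
    and "\<And>e e'. e \<in> arcs G \<Longrightarrow> e' \<in> arcs G \<Longrightarrow> \<alpha> e x * \<alpha> e' y = \<alpha> e' x * \<alpha> e y \<Longrightarrow>
           \<exists>c. \<alpha> e = c *\<^sub>R \<alpha> e'"
  shows "index_count x k = index_count y k"
  using assms
proof (induction "card {e \<in> arcs G. \<alpha> e x * \<alpha> e y < 0}" arbitrary: x rule: less_induct)
  case less
  note x = less.prems(1) and y = less.prems(2)
  let ?D = "{e \<in> arcs G. \<alpha> e x * \<alpha> e y < 0}"
  have finD: "finite ?D" using fin_arcs by simp
  show ?case
  proof (cases "?D = {}")
    case True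
    then have "\<alpha> e x * \<alpha> e y > 0" if "e \<in> arcs G" for e
    proof -
      have "\<alpha> e x \<noteq> 0" "\<alpha> e y \<noteq> 0" using that x y by (auto simp: polarizing_def)
      moreover have "\<not> \<alpha> e x * \<alpha> e y < 0" using True that by blast
      ultimately show ?thesis by (auto simp: not_less order_le_less)
    qed
    then show ?thesis using index_count_cong[OF x] by blast
  next
    case False
    \<comment> \<open>The time at which the segment crosses the wall of \<open>e\<close>. For two
      arcs of \<open>?D\<close>, equal times mean exactly the equation in the third
      hypothesis.\<close>
    define T where "T e = \<alpha> e x / (\<alpha> e x - \<alpha> e y)" for e
    have "Min (T ` ?D) \<in> T ` ?D" using finD False by (intro Min_in) auto
    then obtain e0 where e0: "Min (T ` ?D) = T e0" "e0 \<in> ?D" by (rule imageE)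
    have T_min: "T e0 \<le> T e" if "e \<in> ?D" for e
      unfolding e0(1)[symmetric] by (rule Min_le[OF finite_imageI[OF finD] imageI[OF that]])
    note e0 = e0(2)
    have T01: "0 < T e" "T e < 1" if "e \<in> ?D" for e
      using that by (auto simp: T_def field_simps mult_less_0_iff)
    have xT: "\<alpha> e x = (\<alpha> e x - \<alpha> e y) * T e" and nz: "\<alpha> e x - \<alpha> e y \<noteq> 0" if "e \<in> ?D" for e
      using that by (auto simp: T_def)
    \<comment> \<open>The next crossing time after the first one, or 1 if there is none. Halfway in
      between lies a point \<open>w\<close> just past the first wall and before any other.\<close>
    let ?M = "Min (insert 1 (T ` {e \<in> ?D. T e > T e0}))"
    have fin: "finite (insert 1 (T ` {e \<in> ?D. T e > T e0}))" using fin_arcs by simp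
    define t where "t = (T e0 + ?M) / 2"
    have "?M > T e0" using fin T01[OF e0] by (subst Min_gr_iff) auto
    then have "T e0 < t" "t < ?M" by (auto simp: t_def)
    then have t: "T e0 < t" "t < 1" "\<And>e. e \<in> ?D \<Longrightarrow> T e > T e0 \<Longrightarrow> t < T e"
      using fin by auto
    have t0: "t > 0" using t(1) T01[OF e0] by simp
    define w where "w = x + t *\<^sub>R (y - x)"
    have val: "\<alpha> e w = (1 - t) * \<alpha> e x + t * \<alpha> e y" if "e \<in> arcs G" for e
      using lin[OF that] by (simp add: w_def linear_add linear_cmul linear_diff algebra_simps)
    have valD: "\<alpha> e w = (\<alpha> e x - \<alpha> e y) * (T e - t)" if "e \<in> ?D" for e
    proof -
      have "\<alpha> e w = \<alpha> e x - (\<alpha> e x - \<alpha> e y) * t"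
        using val[of e] that by (simp add: algebra_simps)
      also have "\<dots> = (\<alpha> e x - \<alpha> e y) * T e - (\<alpha> e x - \<alpha> e y) * t"
        using xT[OF that] by simp
      finally show ?thesis by (simp add: algebra_simps)
    qed
    have xw: "\<alpha> e x * \<alpha> e w = (\<alpha> e x - \<alpha> e y)\<^sup>2 * (T e * (T e - t))" if "e \<in> ?D" for e
    proof -
      have "\<alpha> e x * \<alpha> e w = ((\<alpha> e x - \<alpha> e y) * T e) * ((\<alpha> e x - \<alpha> e y) * (T e - t))"
        using xT[OF that] valD[OF that] by simp
      then show ?thesis by (simp add: power2_eq_square ac_simps)
    qed
    have wy: "\<alpha> e w * \<alpha> e y = (\<alpha> e x - \<alpha> e y)\<^sup>2 * ((T e - t) * (T e - 1))" if "e \<in> ?D" for e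
    proof -
      have "\<alpha> e y = (\<alpha> e x - \<alpha> e y) * (T e - 1)"
        using xT[OF that] by (simp add: algebra_simps)
      then have "\<alpha> e w * \<alpha> e y = ((\<alpha> e x - \<alpha> e y) * (T e - t)) * ((\<alpha> e x - \<alpha> e y) * (T e - 1))"
        using valD[OF that] by simp
      then show ?thesis by (simp add: power2_eq_square ac_simps)
    qed
    have notD: "\<alpha> e x * \<alpha> e w > 0 \<and> \<alpha> e w * \<alpha> e y > 0" if e: "e \<in> arcs G" "e \<notin> ?D" for e
    proof -
      have "\<alpha> e x \<noteq> 0" "\<alpha> e y \<noteq> 0" "\<not> \<alpha> e x * \<alpha> e y < 0"
        using x y e by (auto simp: polarizing_def)
      then consider "\<alpha> e x > 0" "\<alpha> e y > 0" | "\<alpha> e x < 0" "\<alpha> e y < 0"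
        by (auto simp: mult_less_0_iff linorder_neq_iff)
      then show ?thesis
      proof cases
        case 1
        then have "\<alpha> e w > 0" using val[OF e(1)] t0 t(2) by (simp add: add_pos_pos)
        with 1 show ?thesis by simp
      next
        case 2
        then have "\<alpha> e w < 0" using val[OF e(1)] t0 t(2) by (simp add: add_neg_neg mult_pos_neg)
        with 2 show ?thesis by (simp add: mult_neg_neg)
      qed
    qed
    have w: "w \<in> polarizing G \<alpha>"
      unfolding polarizing_def
    proof safe
      fix e assume e: "e \<in> arcs G" "\<alpha> e w = 0"
      then have "e \<in> ?D" using notD by force
      moreover from this have "T e \<noteq> t" using t(1,3) T_min[of e] by force
      ultimately show False using valD nz e(2) by auto
    qed
    have crossed: "T e = T e0" if "e \<in> arcs G" "\<alpha> e x * \<alpha> e w < 0" for e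
    proof (rule ccontr)
      assume ne: "T e \<noteq> T e0"
      have e: "e \<in> ?D" using notD that by force
      with ne T_min have "T e > T e0" by force
      then have "t < T e" using t(3) e by blast
      then have "(\<alpha> e x - \<alpha> e y)\<^sup>2 * (T e * (T e - t)) > 0"
        using T01[OF e] nz[OF e] by simp
      with xw[OF e] that show False by simp
    qed
    have "index_count x k = index_count w k"
    proof (rule index_count_wall[OF x w])
      show "e0 \<in> arcs G" using e0 by simp
      have "(\<alpha> e0 x - \<alpha> e0 y)\<^sup>2 * (T e0 * (T e0 - t)) < 0"
        using T01[OF e0] nz[OF e0] t(1) by (simp add: mult_pos_neg)
      with xw[OF e0] show "\<alpha> e0 x * \<alpha> e0 w < 0" by simp
      fix e assume e: "e \<in> arcs G" "\<alpha> e x * \<alpha> e w < 0"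
      then have eD: "e \<in> ?D" using notD by force
      have "\<alpha> e x * (\<alpha> e0 x - \<alpha> e0 y) = \<alpha> e0 x * (\<alpha> e x - \<alpha> e y)"
        using crossed[OF e] nz[OF eD] nz[OF e0] by (simp add: T_def frac_eq_eq)
      then have "\<alpha> e x * \<alpha> e0 y = \<alpha> e0 x * \<alpha> e y" by (simp add: algebra_simps)
      then show "\<exists>c. \<alpha> e = c *\<^sub>R \<alpha> e0"
        using less.prems(3)[of e e0] e(1) e0 by simp
    qed
    also have "\<dots> = index_count y k"
    proof (rule less.hyps[OF _ w y])
      have "(\<alpha> e0 x - \<alpha> e0 y)\<^sup>2 * ((T e0 - t) * (T e0 - 1)) > 0"
        using T01[OF e0] nz[OF e0] t(1) by (simp add: mult_neg_neg)
      then have "\<not> \<alpha> e0 w * \<alpha> e0 y < 0" using wy[OF e0] by simp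
      moreover have "{e \<in> arcs G. \<alpha> e w * \<alpha> e y < 0} \<subseteq> ?D" using notD by force
      ultimately have "{e \<in> arcs G. \<alpha> e w * \<alpha> e y < 0} \<subset> ?D" using e0 by blast
      then show "card {e \<in> arcs G. \<alpha> e w * \<alpha> e y < 0} < card ?D"
        using finD psubset_card_mono by blast
      fix e e' assume e: "e \<in> arcs G" "e' \<in> arcs G" "\<alpha> e w * \<alpha> e' y = \<alpha> e' w * \<alpha> e y"
      \<comment> \<open>Genericity passes to \<open>w\<close>: in the difference of the two products
        the terms with both factors at \<open>y\<close> cancel, leaving \<open>1 - t\<close> times
        the expression at \<open>x\<close>.\<close>
      then have "(1 - t) * (\<alpha> e x * \<alpha> e' y) = (1 - t) * (\<alpha> e' x * \<alpha> e y)"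
        by (simp add: val algebra_simps)
      then have "\<alpha> e x * \<alpha> e' y = \<alpha> e' x * \<alpha> e y" using t(2) by simp
      with less.prems(3) e show "\<exists>c. \<alpha> e = c *\<^sub>R \<alpha> e'" by blast
    qed
    finally show ?thesis .
  qed
qed

text \<open>The endpoint \<open>y\<close> is moved to some \<open>z\<close> with the same signs such
  that the segment from \<open>x\<close> to \<open>z\<close> is generic. Once \<open>x\<close> is
  fixed, each coincidence to be avoided is the kernel of a nonzero functional of \<open>z\<close>,
  so finitely many kernels have to be left.\<close>

lemma index_count_invariant:
  assumes x: "x \<in> polarizing G \<alpha>" and y: "y \<in> polarizing G \<alpha>"
  shows "index_count x k = index_count y k"
proof -
  let ?P = "{(e, e'). e \<in> arcs G \<and> e' \<in> arcs G \<and> (\<nexists>c. \<alpha> e = c *\<^sub>R \<alpha> e')}"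
  let ?\<phi> = "\<lambda>(e, e') v. \<alpha> e x * \<alpha> e' v - \<alpha> e' x * \<alpha> e v"
  have fin: "finite ?P"
    by (rule finite_subset[of _ "arcs G \<times> arcs G"]) (use fin_arcs in auto)
  have linear: "linear (?\<phi> q)" if "q \<in> ?P" for q
    using that lin by (auto simp: linear_iff algebra_simps)
  have nonzero: "\<exists>v. ?\<phi> q v \<noteq> 0" if q: "q \<in> ?P" for q
  proof (rule ccontr)
    assume *: "\<nexists>v. ?\<phi> q v \<noteq> 0"
    obtain e e' where e: "q = (e, e')" by fastforce
    have "\<alpha> e' x \<noteq> 0" using q e x by (auto simp: polarizing_def)
    then have "\<alpha> e = (\<alpha> e x / \<alpha> e' x) *\<^sub>R \<alpha> e'"
      using * e by (simp add: fun_eq_iff field_simps)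
    with q e show False by blast
  qed
  have "\<exists>z. (\<forall>a\<in>\<alpha> ` arcs G. a y \<noteq> 0 \<longrightarrow> a y * a z > 0) \<and> (\<forall>\<phi>\<in>?\<phi> ` ?P. \<phi> z \<noteq> 0)"
  proof (rule perturb_off_kernels)
    show "finite (?\<phi> ` ?P)" using fin by (rule finite_imageI)
    show "finite (\<alpha> ` arcs G)" using fin_arcs by (rule finite_imageI)
    show "\<forall>a\<in>\<alpha> ` arcs G. linear a" using lin by blast
    show "\<forall>\<phi>\<in>?\<phi> ` ?P. linear \<phi>" by (rule ballI, erule imageE, simp only: linear)
    show "\<forall>\<phi>\<in>?\<phi> ` ?P. \<exists>v. \<phi> v \<noteq> 0" by (rule ballI, erule imageE, simp only: nonzero)
  qed
  then obtain z where z: "\<forall>a\<in>\<alpha> ` arcs G. a y \<noteq> 0 \<longrightarrow> a y * a z > 0"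
    and z': "\<forall>\<phi>\<in>?\<phi> ` ?P. \<phi> z \<noteq> 0" by (elim exE conjE) (rule that)
  have yz: "\<forall>e\<in>arcs G. \<alpha> e y * \<alpha> e z > 0" using z y by (auto simp: polarizing_def)
  then have "z \<in> polarizing G \<alpha>" by (force simp: polarizing_def)
  then have "index_count x k = index_count z k"
  proof (rule index_count_generic[OF x])
    fix e e' assume e: "e \<in> arcs G" "e' \<in> arcs G" "\<alpha> e x * \<alpha> e' z = \<alpha> e' x * \<alpha> e z"
    show "\<exists>c. \<alpha> e = c *\<^sub>R \<alpha> e'"
    proof (rule ccontr)
      assume "\<nexists>c. \<alpha> e = c *\<^sub>R \<alpha> e'"
      with e(1,2) have "(e, e') \<in> ?P" by simp
      from bspec[OF z' imageI[OF this]] e(3) show False by simp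
    qed
  qed
  with index_count_cong[OF y yz] show ?thesis by simp
qed

lemma betti_eq_index_count:
  assumes "x \<in> polarizing G \<alpha>"
  shows "betti G \<alpha> k = index_count x k"
proof -
  have "(SOME \<xi>. \<xi> \<in> polarizing G \<alpha>) \<in> polarizing G \<alpha>"
    using assms by (rule someI)
  from index_count_invariant[OF this assms] show ?thesis
    by (simp add: betti_def index_count_def)
qed

end


section \<open>Components of the annihilated subgraphs\<close>

text \<open>\<open>C\<close> is induced on the vertices reachable from \<open>p\<close>, which by
  symmetry can all be reached from one another. The explicit description of its arcs is what allows
  the axial data to be restricted to it.\<close>

lemma symmetric_component_exists:
  assumes "wf_digraph H" "symmetric H" "p \<in> verts H"
  obtains C where "C \<in> components H" "p \<in> verts C" "verts C \<subseteq> verts H"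
    "arcs C = {e \<in> arcs H. tail H e \<in> verts C}" "tail C = tail H" "head C = head H"
    "\<And>e. e \<in> arcs C \<Longrightarrow> head H e \<in> verts C"
proof -
  interpret H: wf_digraph H by fact
  let ?r = "arcs_ends H"
  have sym: "sym ?r" using assms(2) by (simp add: symmetric_def)
  define K where "K = {v. (p, v) \<in> ?r\<^sup>*}"
  have pK: "p \<in> K" by (simp add: K_def)
  have KH: "K \<subseteq> verts H"
  proof
    fix v assume "v \<in> K"
    then have "(p, v) \<in> ?r\<^sup>*" by (simp add: K_def)
    then show "v \<in> verts H"
      by (induction rule: rtrancl_induct) (use assms(3) in \<open>auto simp: arcs_ends_conv\<close>)
  qed
  have closed: "v \<in> K" if "u \<in> K" "(u, v) \<in> ?r" for u v
    using that by (auto simp: K_def)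
  define C where "C = H\<lparr>verts := K, arcs := {e \<in> arcs H. tail H e \<in> K}\<rparr>"
  have C: "verts C = K" "arcs C = {e \<in> arcs H. tail H e \<in> K}" "tail C = tail H" "head C = head H"
    by (simp_all add: C_def)
  have headK: "head H e \<in> K" if "e \<in> arcs C" for e
    using that closed[of "tail H e"] by (auto simp: C arcs_ends_conv)
  have ends: "arcs_ends C = {(u, v) \<in> ?r. u \<in> K}"
    by (auto simp: arcs_ends_conv C)
  have symC: "sym (arcs_ends C)"
    using sym closed unfolding ends by (auto simp: sym_def)
  have wfC: "wf_digraph C" using KH headK by unfold_locales (auto simp: C)
  have sub: "subgraph C H"
    unfolding subgraph_def using KH wfC assms(1) by (auto simp: C compatible_def)
  have reach: "(p, v) \<in> rtrancl_on K (arcs_ends C)" if "v \<in> K" for v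
  proof -
    have "(p, v) \<in> ?r\<^sup>*" using that by (simp add: K_def)
    then show ?thesis
    proof (induction rule: rtrancl_induct)
      case base
      then show ?case using pK by simp
    next
      case (step u v)
      have "u \<in> K" using step(1) by (simp add: K_def)
      moreover from this have "v \<in> K" using closed step(2) by blast
      ultimately show ?case
        using step(2) by (intro rtrancl_on_into_rtrancl_on[OF step.IH]) (simp_all add: ends)
    qed
  qed
  have "(u, v) \<in> rtrancl_on K (arcs_ends C)" if uv: "u \<in> K" "v \<in> K" for u v
    by (rule rtrancl_on_trans[OF symD[OF rtrancl_on_sym[OF symC] reach[OF uv(1)]] reach[OF uv(2)]])
  then have conn: "Digraph_Component.connected C"
    unfolding connected_conv using pK
    by (auto simp: C(1) intro: rtrancl_on_mono[of "arcs_ends C" _ K K] simp: symcl_def)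
  \<comment> \<open>Maximality: a connected graph between \<open>C\<close> and \<open>H\<close>
    contains only vertices reachable from \<open>p\<close>, as its undirected paths are paths of the
    symmetric relation \<open>?r\<close>.\<close>
  have "C = H'" if H': "subgraph C H'" "subgraph H' H" "Digraph_Component.connected H'" for H'
  proof -
    have eq: "tail H' = tail H" "head H' = head H"
      using H'(2) by (auto simp: subgraph_def compatible_def)
    have "verts H' \<subseteq> K"
    proof
      fix v assume v: "v \<in> verts H'"
      have "p \<in> verts H'" using H'(1) pK C(1) by (auto simp: subgraph_def)
      then have "(p, v) \<in> rtrancl_on (verts H') ((arcs_ends H')\<^sup>s)"
        using H'(3) v unfolding connected_conv by blast
      then have "(p, v) \<in> ((arcs_ends H')\<^sup>s)\<^sup>*" by (rule rtrancl_on_rtranclI)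
      moreover have "arcs_ends H' \<subseteq> ?r"
        using H'(2) eq by (auto simp: subgraph_def arcs_ends_conv)
      then have "(arcs_ends H')\<^sup>s \<subseteq> ?r" using sym by (auto simp: symcl_def sym_def)
      ultimately have "(p, v) \<in> ?r\<^sup>*" using rtrancl_mono by blast
      then show "v \<in> K" by (simp add: K_def)
    qed
    then have "verts H' = K" using H'(1) C(1) by (auto simp: subgraph_def)
    moreover have "arcs H' = arcs C"
    proof
      show "arcs C \<subseteq> arcs H'" using H'(1) by (simp add: subgraph_def)
      show "arcs H' \<subseteq> arcs C"
        using H'(2) \<open>verts H' = K\<close> eq wf_digraph.tail_in_verts[of H']
        by (auto simp: subgraph_def C)
    qed
    ultimately show ?thesis using C eq by simp
  qed
  then have "C \<in> components H"
    unfolding components_def pre_digraph.max_subgraph_def using sub conn by blast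
  with that[of C] pK KH C headK show thesis by simp
qed

section \<open>Separating vectors from linear independence, and codimension 2 kernels\<close>

lemma indep_family_pair:
  assumes "indep_family v {i, j}" "i \<noteq> j"
  shows "v i \<noteq> c *\<^sub>R v j"
proof
  assume eq: "v i = c *\<^sub>R v j"
  have ne: "v i \<noteq> v j" using assms by (auto simp: indep_family_def)
  have "v i \<in> span {v j}" unfolding eq by (intro real_vector.span_scale real_vector.span_base) simp
  also have "{v j} = v ` {i, j} - {v i}" using ne by auto
  finally show False
    using assms(1) unfolding indep_family_def real_vector.dependent_def
    by (metis image_eqI insertI1)
qed

text \<open>Without such a \<open>w\<close>, \<open>functional_in_span\<close> would put
  \<open>v i\<close> into the span of the other two. The case \<open>j = k\<close> is allowed and is
  used for pairs.\<close>

lemma indep_family_triple_functional: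
  fixes v :: "'i \<Rightarrow> 'g::real_vector \<Rightarrow> real"
  assumes "indep_family v {i, j, k}" "i \<noteq> j" "i \<noteq> k" "\<forall>l\<in>{i, j, k}. linear (v l)"
  shows "\<exists>w. v i w \<noteq> 0 \<and> v j w = 0 \<and> v k w = 0"
proof (rule ccontr)
  assume "\<nexists>w. v i w \<noteq> 0 \<and> v j w = 0 \<and> v k w = 0"
  then have "v i \<in> span {v j, v k}"
    using assms(4) by (intro functional_in_span) auto
  moreover have "{v j, v k} = v ` {i, j, k} - {v i}"
    using assms(1-3) by (auto simp: indep_family_def)
  ultimately show False
    using assms(1) unfolding indep_family_def real_vector.dependent_def
    by (metis image_eqI insertI1)
qed

lemma dim_common_kernel:
  fixes a b :: "'g::real_vector \<Rightarrow> real"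
  assumes "finite_dim (UNIV :: 'g set)" "linear a" "linear b" "a v \<noteq> 0"
    and "b w \<noteq> 0" "a w = 0"
  shows "dim {x. a x = 0 \<and> b x = 0} + 2 = dim (UNIV :: 'g set)"
proof -
  have "dim (UNIV :: 'g set) = Suc (dim {x. a x = 0})"
    using dim_kernel_functional[OF assms(2) real_vector.subspace_UNIV assms(1) _ assms(4)] by simp
  also have "dim {x. a x = 0} = Suc (dim ({x. a x = 0} \<inter> {x. b x = 0}))"
    using assms finite_dim_subset
    by (intro dim_kernel_functional[of b _ w] linear_subspace_kernel) auto
  also have "{x. a x = 0} \<inter> {x. b x = 0} = {x. a x = 0 \<and> b x = 0}" by auto
  finally show ?thesis by simp
qed

context axial_graph
begin

text \<open>On a loop, \<open>e\<close> and \<open>arev e\<close> would be two arcs out of the same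
  vertex with proportional axial values.\<close>

lemma no_loop:
  assumes "e \<in> arcs G" "arev e \<noteq> e"
  shows "tail G e \<noteq> head G e"
proof
  assume "tail G e = head G e"
  then have "tail G (arev e) = tail G e" using tail_rev[OF assms(1)] by simp
  moreover obtain r where "\<alpha> (arev e) = (- r) *\<^sub>R \<alpha> e"
    using opposite[OF assms(1)] scaleR_minus_left by metis
  ultimately show False using not_parallel[OF rev_in[OF assms(1)] assms(1) _ assms(2)] by blast
qed

lemma rev_value_iff:
  assumes "e \<in> arcs G"
  shows "\<alpha> (arev e) x = 0 \<longleftrightarrow> \<alpha> e x = 0" "\<alpha> (arev e) x < 0 \<longleftrightarrow> \<alpha> e x > 0" "\<alpha> (arev e) x > 0 \<longleftrightarrow> \<alpha> e x < 0"
proof -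
  obtain r where "r > 0" "\<alpha> (arev e) = - (r *\<^sub>R \<alpha> e)" using opposite[OF assms] by blast
  then show "\<alpha> (arev e) x = 0 \<longleftrightarrow> \<alpha> e x = 0" "\<alpha> (arev e) x < 0 \<longleftrightarrow> \<alpha> e x > 0"
    "\<alpha> (arev e) x > 0 \<longleftrightarrow> \<alpha> e x < 0"
    by (auto simp: zero_less_mult_iff mult_less_0_iff)
qed

lemma annihilator_iff: "e \<in> arcs G \<Longrightarrow> \<alpha> e \<in> annihilator h \<longleftrightarrow> (\<forall>x\<in>h. \<alpha> e x = 0)"
  using lin by (auto simp: annihilator_def)

text \<open>Along an arc with \<open>\<alpha> e\<close> zero on \<open>h\<close>, transport
  multiplies the restriction of an axial value to \<open>h\<close> by a positive number. So the
  connection preserves the arcs that annihilate \<open>h\<close>, and the invariance of the index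
  counts applies to \<open>C\<close>.\<close>

lemma axial_graph_annihilated:
  assumes "verts C \<subseteq> verts G" "tail C = tail G" "head C = head G"
    and arcsC: "arcs C = {e \<in> arcs G. tail G e \<in> verts C \<and> \<alpha> e \<in> annihilator h}"
    and "\<And>e. e \<in> arcs C \<Longrightarrow> head G e \<in> verts C"
  shows "axial_graph C arev \<theta> \<alpha>"
proof (rule axial_graph.intro)
  show "finite (verts C)" using assms(1) fin_verts finite_subset by blast
  show "finite (arcs C)" unfolding arcsC using fin_arcs by simp
  fix e assume e: "e \<in> arcs C"
  then have eG: "e \<in> arcs G" by (simp add: arcsC)
  show "tail C e \<in> verts C" using e assms(2) by (simp add: arcsC)
  show "head C e \<in> verts C" using e assms(3,5) by simp
  show "arev e \<in> arcs C"
  proof -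
    have "\<alpha> (arev e) \<in> annihilator h"
      using e unfolding annihilator_iff[OF rev_in[OF eG]] rev_value_iff(1)[OF eG]
      by (simp add: arcsC annihilator_iff[OF eG])
    then show ?thesis using assms(5)[OF e] rev_in[OF eG] tail_rev[OF eG] by (simp add: arcsC)
  qed
  show "tail C (arev e) = head C e" "head C (arev e) = tail C e"
    using tail_rev[OF eG] head_rev[OF eG] assms(2,3) by auto
  show "linear (\<alpha> e)" by (rule lin[OF eG])
  show "\<exists>r>0. \<alpha> (arev e) = - (r *\<^sub>R \<alpha> e)" by (rule opposite[OF eG])
  have out: "out_arcs C p = {e' \<in> out_arcs G p. \<alpha> e' \<in> annihilator h}" if "p \<in> verts C" for p
    using that by (auto simp: arcsC assms(2))
  have "\<alpha> (\<theta> e e') \<in> annihilator h \<longleftrightarrow> \<alpha> e' \<in> annihilator h" if e': "e' \<in> out_arcs G (tail G e)" for e'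
  proof -
    have e'G: "e' \<in> arcs G" using e' by simp
    have im: "\<theta> e e' \<in> arcs G" using bij_betwE[OF conn[OF eG]] e' by auto
    obtain l c where "l > 0" "\<alpha> (\<theta> e e') = l *\<^sub>R \<alpha> e' + c *\<^sub>R \<alpha> e"
      using transport[OF eG e'] by blast
    moreover have "\<forall>x\<in>h. \<alpha> e x = 0" using e eG by (simp add: arcsC annihilator_iff)
    ultimately show ?thesis
      unfolding annihilator_iff[OF im] annihilator_iff[OF e'G] by simp
  qed
  then have "bij_betw (\<theta> e) {e' \<in> out_arcs G (tail G e). \<alpha> e' \<in> annihilator h}
      {e' \<in> out_arcs G (head G e). \<alpha> e' \<in> annihilator h}"
    by (intro bij_betw_Collect[OF conn[OF eG]])
  then show "bij_betw (\<theta> e) (out_arcs C (tail C e)) (out_arcs C (head C e))"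
    using out[of "tail G e"] out[of "head G e"] e assms(2,3,5) by (simp add: arcsC)
  show "\<exists>l c. l > 0 \<and> \<alpha> (\<theta> e e') = l *\<^sub>R \<alpha> e' + c *\<^sub>R \<alpha> e" if "e' \<in> out_arcs C (tail C e)" for e'
    using that eG assms(2) by (intro transport) (auto simp: arcsC)
  show "\<alpha> e \<noteq> c *\<^sub>R \<alpha> e'" if "e' \<in> arcs C" "tail C e = tail C e'" "e \<noteq> e'" for e' c
    using that eG assms(2) by (intro not_parallel) (auto simp: arcsC)
qed

text \<open>
  From any vertex one can descend to a vertex of index 0; if that vertex is unique, any two
  vertices are joined by a path that stays below them.
\<close>

lemma edge_constant_on_lower_set:
  assumes wf: "wf R" and R: "\<And>e. e \<in> arcs G \<Longrightarrow> \<alpha> e \<xi> < 0 \<Longrightarrow> (head G e, tail G e) \<in> R"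
    and U: "\<And>e. e \<in> arcs G \<Longrightarrow> tail G e \<in> U \<Longrightarrow> \<alpha> e \<xi> < 0 \<Longrightarrow> head G e \<in> U"
    and g: "\<And>e. e \<in> arcs G \<Longrightarrow> tail G e \<in> U \<Longrightarrow> head G e \<in> U \<Longrightarrow> g (tail G e) = g (head G e)"
    and one: "index_count \<xi> 0 = 1"
    and "q \<in> verts G" "q \<in> U" "q' \<in> verts G" "q' \<in> U"
  shows "g q = g q'"
proof -
  have desc: "\<exists>u\<in>verts G. vertex_index G \<alpha> \<xi> u = 0 \<and> g q = g u"
    if "q \<in> verts G" "q \<in> U" for q
    using wf that
  proof (induction q rule: wf_induct_rule)
    case (less q)
    show ?case
    proof (cases "vertex_index G \<alpha> \<xi> q = 0")
      case True
      then show ?thesis using less.prems by blast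
    next
      case False
      then obtain e where "e \<in> out_arcs G q" "\<alpha> e \<xi> < 0"
        unfolding vertex_index_def by (metis (no_types, lifting) card.empty empty_Collect_eq)
      then have e: "e \<in> arcs G" "tail G e = q" "\<alpha> e \<xi> < 0" by auto
      then have "head G e \<in> U" using U less.prems by blast
      moreover have "g q = g (head G e)" using g[OF e(1)] e less.prems \<open>head G e \<in> U\<close> by simp
      ultimately show ?thesis
        using less.IH[of "head G e"] R[OF e(1,3)] e(2) head_in[OF e(1)] by auto
    qed
  qed
  obtain u where "{p \<in> verts G. vertex_index G \<alpha> \<xi> p = 0} = {u}"
    using one unfolding index_count_def by (rule card_1_singletonE)
  then have "v = u" if "v \<in> verts G" "vertex_index G \<alpha> \<xi> v = 0" for v
    using that by blast
  then show ?thesis using desc[of q] desc[of q'] assms(6-9) by metis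
qed

end


section \<open>Building up the cohomology vertex by vertex\<close>

definition up_graph ::
    "('v, 'e) pre_digraph \<Rightarrow> ('e \<Rightarrow> 'g::real_vector \<Rightarrow> real) \<Rightarrow> 'g \<Rightarrow> ('v, 'e) pre_digraph" where
  "up_graph G \<alpha> \<xi> = G\<lparr>arcs := {e \<in> arcs G. \<alpha> e \<xi> > 0}\<rparr>"

text \<open>The edge condition is agreement on the hyperplane where \<open>\<alpha> e\<close>
  vanishes, so that it can be tested at single points; \<open>cohomology_part_eq\<close> compares it
  with divisibility. Arcs leaving \<open>U\<close> impose nothing.\<close>

definition partial_classes ::
    "('v, 'e) pre_digraph \<Rightarrow> ('e \<Rightarrow> 'g::real_vector \<Rightarrow> real) \<Rightarrow> nat \<Rightarrow> 'v set \<Rightarrow> ('v \<Rightarrow> 'g \<Rightarrow> real) set" where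
  "partial_classes G \<alpha> m U =
     {f. (\<forall>p\<in>U. f p \<in> sym_power m) \<and> (\<forall>p. p \<notin> U \<longrightarrow> f p = 0) \<and>
         (\<forall>e\<in>arcs G. tail G e \<in> U \<longrightarrow> head G e \<in> U \<longrightarrow>
            (\<forall>x. \<alpha> e x = 0 \<longrightarrow> f (tail G e) x = f (head G e) x))}"

lemma subspace_partial_classes: "subspace (partial_classes G \<alpha> m U)"
proof -
  show ?thesis
    unfolding real_vector.subspace_def
  proof (intro conjI ballI allI)
    show "0 \<in> partial_classes G \<alpha> m U"
      by (simp add: partial_classes_def real_vector.subspace_0[OF subspace_sym_power])
  next
    fix f g assume "f \<in> partial_classes G \<alpha> m U" "g \<in> partial_classes G \<alpha> m U"
    then show "f + g \<in> partial_classes G \<alpha> m U"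
      unfolding partial_classes_def by (simp add: real_vector.subspace_add[OF subspace_sym_power])
  next
    fix f c assume "f \<in> partial_classes G \<alpha> m U"
    then show "c *\<^sub>R f \<in> partial_classes G \<alpha> m U"
      unfolding partial_classes_def by (simp add: real_vector.subspace_scale[OF subspace_sym_power])
  qed
qed

text \<open>The quotient from \<open>prod_dvd_on\<close> has no known degree. Rescaling
  \<open>x\<close> shows that it scales with exponent \<open>m - card I\<close> wherever the product
  is nonzero, so its homogeneous component serves as \<open>g\<close>; elsewhere both sides are
  zero. If \<open>card I > m\<close>, then \<open>f x\<close> equals \<open>t ^ (card I - m)\<close>
  times a bounded quantity near \<open>t = 0\<close>, hence is zero.\<close>

lemma multiples_in_sym_power:
  fixes a :: "'i \<Rightarrow> 'g::real_vector \<Rightarrow> real"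
  assumes "finite I" "\<And>i. i \<in> I \<Longrightarrow> linear (a i)" "\<And>i. i \<in> I \<Longrightarrow> \<exists>w. a i w \<noteq> 0"
    and pairs: "\<And>i j. i \<in> I \<Longrightarrow> j \<in> I \<Longrightarrow> i \<noteq> j \<Longrightarrow> \<exists>w. a i w \<noteq> 0 \<and> a j w = 0"
    and f: "f \<in> sym_power m" "\<And>i x. i \<in> I \<Longrightarrow> a i x = 0 \<Longrightarrow> f x = 0"
  shows "if card I \<le> m then \<exists>g\<in>sym_power (m - card I). f = (\<Prod>i\<in>I. a i) * g else f = 0"
proof -
  have "\<exists>q\<in>sym_algebra. \<forall>x\<in>UNIV. f x = (\<Prod>i\<in>I. a i x) * q x"
    using assms subsetD[OF sym_power_subset f(1)] by (intro prod_dvd_on) auto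
  then obtain q where q: "q \<in> sym_algebra" "\<And>x. f x = (\<Prod>i\<in>I. a i x) * q x" by blast
  let ?P = "\<lambda>x. \<Prod>i\<in>I. a i x"
  have scale: "t ^ m * f x = t ^ card I * ?P x * q (t *\<^sub>R x)" for t x
  proof -
    have "t ^ m * f x = ?P (t *\<^sub>R x) * q (t *\<^sub>R x)"
      using sym_power_homogeneous[OF f(1)] q(2) by metis
    also have "?P (t *\<^sub>R x) = t ^ card I * ?P x"
    proof -
      have "?P (t *\<^sub>R x) = (\<Prod>i\<in>I. t * a i x)"
        using assms(2) by (intro prod.cong) (auto simp: linear_cmul)
      then show ?thesis by (simp add: prod.distrib)
    qed
    finally show ?thesis .
  qed
  show ?thesis
  proof (cases "card I \<le> m")
    case True
    obtain g where g: "g \<in> sym_power (m - card I)"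
      "\<And>x. (\<forall>t>0. q (t *\<^sub>R x) = t ^ (m - card I) * q x) \<Longrightarrow> g x = q x"
      using homogeneous_component[OF q(1)] by blast
    have "f x = ?P x * g x" for x
    proof (cases "?P x = 0")
      case True
      then show ?thesis using q(2) by simp
    next
      case False
      have "q (t *\<^sub>R x) = t ^ (m - card I) * q x" if "t > 0" for t
      proof -
        have "t ^ m = t ^ card I * t ^ (m - card I)"
          using True \<open>card I \<le> m\<close> by (simp flip: power_add)
        then have "t ^ card I * ?P x * (t ^ (m - card I) * q x) = t ^ card I * ?P x * q (t *\<^sub>R x)"
          using scale[of t x] q(2)[of x] by (simp add: ac_simps)
        then show ?thesis using False that by simp
      qed
      then show ?thesis using g(2) q(2) by simp
    qed
    then have "f = (\<Prod>i\<in>I. a i) * g" by (intro ext) (simp add: prod_fun_apply)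
    then show ?thesis using g(1) True by auto
  next
    case False
    have "f x = 0" for x
    proof -
      have "continuous_on UNIV (\<lambda>t. q (0 + t *\<^sub>R x))"
        by (rule continuous_on_line[OF q(1)])
      then have "((\<lambda>t. q (0 + t *\<^sub>R x)) \<longlongrightarrow> q (0 + 0 *\<^sub>R x)) (at 0)"
        unfolding continuous_on_def by (metis UNIV_I)
      then have "((\<lambda>t. q (t *\<^sub>R x)) \<longlongrightarrow> q 0) (at 0)" by simp
      then have "((\<lambda>t. t ^ (card I - m) * ?P x * q (t *\<^sub>R x)) \<longlongrightarrow> 0 ^ (card I - m) * ?P x * q 0) (at 0)"
        by (intro tendsto_intros)
      moreover have "0 ^ (card I - m) * ?P x * q 0 = 0" using False by (simp add: power_0_left)
      moreover have "t ^ (card I - m) * ?P x * q (t *\<^sub>R x) = f x" if "t \<noteq> 0" for t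
      proof -
        have "t ^ card I = t ^ m * t ^ (card I - m)"
          using False by (simp flip: power_add)
        then have "t ^ m * (t ^ (card I - m) * ?P x * q (t *\<^sub>R x)) = t ^ m * f x"
          unfolding scale by (simp add: ac_simps)
        then show ?thesis using that by simp
      qed
      then have "((\<lambda>t. t ^ (card I - m) * ?P x * q (t *\<^sub>R x)) \<longlongrightarrow> f x) (at 0)"
        by (intro tendsto_eventually) (auto simp: eventually_at_filter)
      ultimately show ?thesis
        using tendsto_unique[of "at (0::real)" "\<lambda>t. t ^ (card I - m) * ?P x * q (t *\<^sub>R x)" "f x" 0]
        by simp
    qed
    then show ?thesis using False by (auto simp: fun_eq_iff)
  qed
qed

context abstract_one_skeleton
begin

lemma axial_graph: "axial_graph G arev \<theta> \<alpha>"
proof (rule axial_graph.intro)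
  fix e assume e: "e \<in> arcs G"
  show "bij_betw (\<theta> e) (out_arcs G (tail G e)) (out_arcs G (head G e))"
    by (rule connection_bij[OF e])
  show "linear (\<alpha> e)" by (rule axial_linear[OF e])
  show "\<exists>r>0. \<alpha> (arev e) = - (r *\<^sub>R \<alpha> e)"
  proof -
    obtain r s where rs: "r > 0" "s > 0" "s *\<^sub>R \<alpha> (arev e) = - (r *\<^sub>R \<alpha> e)"
      using A2[OF e] by blast
    have "\<alpha> (arev e) = (1 / s) *\<^sub>R (s *\<^sub>R \<alpha> (arev e))" using rs(2) by simp
    also have "\<dots> = - ((r / s) *\<^sub>R \<alpha> e)" unfolding rs(3) by (simp add: scaleR_minus_right)
    finally show ?thesis using rs by (intro exI[of _ "r / s"]) simp
  qed
  show "\<exists>l c. l > 0 \<and> \<alpha> (\<theta> e e') = l *\<^sub>R \<alpha> e' + c *\<^sub>R \<alpha> e" if "e' \<in> out_arcs G (tail G e)" for e'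
    using A3[OF e that] .
  show "\<alpha> e \<noteq> c *\<^sub>R \<alpha> e'" if "e' \<in> arcs G" "tail G e = tail G e'" "e \<noteq> e'" for e' c
    using that e by (intro indep_family_pair[OF A1[of "tail G e"]]) auto
qed (use head_arev in auto)

end

locale non_cyclic_skeleton = abstract_one_skeleton G arev d \<theta> \<alpha>
  for G :: "('v, 'e) pre_digraph" and arev d \<theta> and \<alpha> :: "'e \<Rightarrow> 'g::real_vector \<Rightarrow> real" +
  fixes \<xi> :: 'g
  assumes fin_dim: "finite_dim (UNIV :: 'g set)"
    and three_indep: "three_independent G \<alpha>"
    and polarizing: "\<xi> \<in> polarizing G \<alpha>"
    and acyclic_up: "\<nexists>c. pre_digraph.cycle (up_graph G \<alpha> \<xi>) c"
    and unique_min: "\<And>h C. subspace h \<Longrightarrow> dim h + 2 = dim (UNIV :: 'g set) \<Longrightarrow>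
          C \<in> components (annihilated_subgraph G \<alpha> h) \<Longrightarrow> betti C \<alpha> 0 = 1"
begin

sublocale axial_graph G arev \<theta> \<alpha>
  by (rule axial_graph)

lemma value_nonzero: "e \<in> arcs G \<Longrightarrow> \<alpha> e \<xi> \<noteq> 0"
  using polarizing by (simp add: polarizing_def)

lemma finite_up: "finite (arcs_ends (up_graph G \<alpha> \<xi>))"
  by (simp add: arcs_ends_conv up_graph_def)

text \<open>A nonempty closed walk contains a cycle. For a finite relation, acyclicity gives
  well-foundedness in both directions: one for descending to a minimum, the other for choosing a top
  vertex.\<close>

lemma up_acyclic: "acyclic (arcs_ends (up_graph G \<alpha> \<xi>))"
proof -
  interpret up: wf_digraph "up_graph G \<alpha> \<xi>"
    by unfold_locales (auto simp: up_graph_def)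
  show ?thesis
  proof (rule acyclicI, rule allI, rule notI)
    fix u assume "(u, u) \<in> (arcs_ends (up_graph G \<alpha> \<xi>))\<^sup>+"
    then obtain p where "up.awalk u p u" "p \<noteq> []" using up.reachable1_awalk by blast
    then have "up.closed_w p" by (auto simp: up.closed_w_def)
    then show False using up.closed_w_imp_cycle acyclic_up by blast
  qed
qed

lemma down_arc_up:
  assumes "e \<in> arcs G" "\<alpha> e \<xi> < 0"
  shows "(head G e, tail G e) \<in> arcs_ends (up_graph G \<alpha> \<xi>)"
proof -
  have "arev e \<in> arcs (up_graph G \<alpha> \<xi>)"
    using rev_in[OF assms(1)] rev_value_iff(3)[OF assms(1)] assms(2) by (simp add: up_graph_def)
  then show ?thesis
    unfolding arcs_ends_conv using tail_rev[OF assms(1)] head_rev[OF assms(1)]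
    by (intro image_eqI[of _ _ "arev e"]) (auto simp: up_graph_def)
qed

section \<open>Lower sets and the extension of classes by one vertex\<close>

definition lower_set :: "'v set \<Rightarrow> bool" where
  "lower_set U \<longleftrightarrow> U \<subseteq> verts G \<and> (\<forall>e\<in>arcs G. tail G e \<in> U \<longrightarrow> \<alpha> e \<xi> < 0 \<longrightarrow> head G e \<in> U)"

definition down_arcs :: "'v \<Rightarrow> 'e set" where
  "down_arcs p = {e \<in> out_arcs G p. \<alpha> e \<xi> < 0}"

lemma card_down_arcs: "card (down_arcs p) = vertex_index G \<alpha> \<xi> p"
  by (simp add: down_arcs_def vertex_index_def)

lemma down_arcsD: "e \<in> down_arcs p \<Longrightarrow> e \<in> arcs G \<and> tail G e = p \<and> \<alpha> e \<xi> < 0"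
  by (simp add: down_arcs_def)

lemma finite_down_arcs: "finite (down_arcs p)"
  by (simp add: down_arcs_def)

lemma down_arcs_pair:
  assumes "i \<in> down_arcs p" "j \<in> down_arcs p" "i \<noteq> j"
  shows "\<exists>w. \<alpha> i w \<noteq> 0 \<and> \<alpha> j w = 0"
proof -
  note i = down_arcsD[OF assms(1)] and j = down_arcsD[OF assms(2)]
  have "p \<in> verts G" using i by auto
  then have "indep_family \<alpha> {i, j}" using i j assms(3) by (intro A1) auto
  then show ?thesis
    using indep_family_triple_functional[of \<alpha> i j j] assms(3) i j axial_linear by auto
qed

lemma down_arcs_triple:
  assumes "i \<in> down_arcs p" "j \<in> down_arcs p" "k \<in> down_arcs p" "i \<noteq> j" "i \<noteq> k" "j \<noteq> k"
  shows "\<exists>w. \<alpha> i w \<noteq> 0 \<and> \<alpha> j w = 0 \<and> \<alpha> k w = 0"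
proof -
  note i = down_arcsD[OF assms(1)] and j = down_arcsD[OF assms(2)] and k = down_arcsD[OF assms(3)]
  have "p \<in> verts G" using i by auto
  then have "indep_family \<alpha> {i, j, k}"
    using three_indep i j k assms(4-6) unfolding three_independent_def by auto
  then show ?thesis
    using assms(4,5) i j k axial_linear by (intro indep_family_triple_functional) auto
qed

lemma no_loops: "e \<in> arcs G \<Longrightarrow> tail G e \<noteq> head G e"
  using no_loop arev_neq by blast

text \<open>
  The two lower neighbours lie in one component of \<open>\<Gamma>\<^sub>h\<close>, where \<open>h\<close> is the common kernel;
  by (NCA2) they are joined there by a path below \<open>p\<close>, and every edge on it kills \<open>h\<close>.
\<close>

lemma lower_neighbours_agree:
  assumes U: "lower_set U" and f: "f \<in> partial_classes G \<alpha> m U"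
    and ij: "i \<in> down_arcs p" "j \<in> down_arcs p" "i \<noteq> j" and hU: "head G i \<in> U" "head G j \<in> U"
    and x: "\<alpha> i x = 0" "\<alpha> j x = 0"
  shows "f (head G i) x = f (head G j) x"
proof -
  note i = down_arcsD[OF ij(1)] and j = down_arcsD[OF ij(2)]
  let ?h = "{x. \<alpha> i x = 0 \<and> \<alpha> j x = 0}"
  let ?H = "annihilated_subgraph G \<alpha> ?h"
  have sub: "subspace ?h"
    using axial_linear i j by (auto simp: real_vector.subspace_def linear_0 linear_add linear_cmul)
  have dim: "dim ?h + 2 = dim (UNIV :: 'g set)"
  proof -
    obtain v where "\<alpha> i v \<noteq> 0" using down_arcs_pair[OF ij] by blast
    moreover obtain w where "\<alpha> j w \<noteq> 0" "\<alpha> i w = 0" using down_arcs_pair[of j p i] ij by auto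
    ultimately show ?thesis using fin_dim axial_linear i j by (intro dim_common_kernel) auto
  qed
  have H: "arcs ?H = {e \<in> arcs G. \<alpha> e \<in> annihilator ?h}" "verts ?H = verts G"
    "tail ?H = tail G" "head ?H = head G"
    by (simp_all add: annihilated_subgraph_def)
  have wfH: "wf_digraph ?H" by unfold_locales (auto simp: H)
  have revH: "arev e \<in> arcs ?H" if "e \<in> arcs ?H" for e
  proof -
    have eG: "e \<in> arcs G" using that by (simp add: H)
    have "\<alpha> (arev e) \<in> annihilator ?h"
      using that unfolding annihilator_iff[OF rev_in[OF eG]] rev_value_iff(1)[OF eG]
      by (simp add: H annihilator_iff[OF eG])
    then show ?thesis using rev_in[OF eG] by (simp add: H)
  qed
  have "symmetric ?H"
    unfolding symmetric_conv
  proof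
    fix e assume e: "e \<in> arcs ?H"
    then have "e \<in> arcs G" by (simp add: H)
    then show "\<exists>e2\<in>arcs ?H. tail ?H e = head ?H e2 \<and> head ?H e = tail ?H e2"
      using revH[OF e] by (intro bexI[of _ "arev e"]) (simp_all add: H)
  qed
  moreover have "p \<in> verts ?H" using i by (auto simp: H)
  ultimately obtain C where C: "C \<in> components ?H" "p \<in> verts C" "verts C \<subseteq> verts ?H"
    "arcs C = {e \<in> arcs ?H. tail ?H e \<in> verts C}" "tail C = tail ?H" "head C = head ?H"
    and headC: "\<And>e. e \<in> arcs C \<Longrightarrow> head ?H e \<in> verts C"
    using symmetric_component_exists[OF wfH] by blast
  have arcsC: "arcs C = {e \<in> arcs G. tail G e \<in> verts C \<and> \<alpha> e \<in> annihilator ?h}"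
    using C(4) H by auto
  interpret C: axial_graph C arev \<theta> \<alpha>
    using C(3,5,6) H headC by (intro axial_graph_annihilated[OF _ _ _ arcsC]) auto
  have "\<xi> \<in> polarizing C \<alpha>"
    using polarizing arcsC by (auto simp: polarizing_def)
  \<comment> \<open>Here invariance on the component is used: (NCA2) speaks of the vector chosen by
    \<open>betti C\<close>, the descent of \<open>\<xi>\<close>.\<close>
  then have one: "C.index_count \<xi> 0 = 1"
    using unique_min[OF sub dim C(1)] C.betti_eq_index_count by simp
  have "i \<in> arcs C" "j \<in> arcs C"
    using i j C(2) by (auto simp: arcsC annihilator_iff)
  then have hC: "head G i \<in> verts C" "head G j \<in> verts C"
    using headC H by auto
  let ?g = "\<lambda>v. f v x"
  show ?thesis
  proof (rule C.edge_constant_on_lower_set[of _ \<xi> U ?g, OF _ _ _ _ one hC(1) hU(1) hC(2) hU(2)])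
    show "wf (arcs_ends (up_graph G \<alpha> \<xi>))"
      by (rule finite_acyclic_wf[OF finite_up up_acyclic])
    fix e assume eC: "e \<in> arcs C"
    then have e: "e \<in> arcs G" by (simp add: arcsC)
    show "(head C e, tail C e) \<in> arcs_ends (up_graph G \<alpha> \<xi>)" if "\<alpha> e \<xi> < 0"
      using down_arc_up[OF e that] C(5,6) H by simp
    show "head C e \<in> U" if "tail C e \<in> U" "\<alpha> e \<xi> < 0"
      using U e that C(5,6) H unfolding lower_set_def by simp
    show "f (tail C e) x = f (head C e) x" if "tail C e \<in> U" "head C e \<in> U"
    proof -
      have "\<alpha> e x = 0"
        using eC x annihilator_iff[OF e] by (simp add: arcsC)
      then show ?thesis using f e that C(5,6) H by (simp add: partial_classes_def)
    qed
  qed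
qed

text \<open>An ascending arc from \<open>p\<close> into \<open>U\<close> would, when reversed,
  descend from \<open>U\<close> to \<open>p\<close> and force \<open>p\<close> into
  \<open>U\<close>.\<close>

lemma new_vertex_arc:
  assumes "lower_set U" "p \<notin> U" "e \<in> arcs G" "tail G e = p" "head G e \<in> insert p U"
  shows "e \<in> down_arcs p \<and> head G e \<in> U"
proof -
  have head: "head G e \<in> U" using assms(4,5) no_loops[OF assms(3)] by auto
  have "\<not> \<alpha> e \<xi> > 0"
  proof
    assume "\<alpha> e \<xi> > 0"
    then have "\<alpha> (arev e) \<xi> < 0" using rev_value_iff(2)[OF assms(3)] by simp
    then have "head G (arev e) \<in> U"
      using assms(1) rev_in[OF assms(3)] tail_rev[OF assms(3)] head unfolding lower_set_def by simp
    then show False using head_rev[OF assms(3)] assms(2,4) by simp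
  qed
  then show ?thesis
    using value_nonzero[OF assms(3)] assms(3,4) head by (auto simp: down_arcs_def)
qed

lemma partial_class_insertI:
  assumes U: "lower_set U" "p \<notin> U" and f: "f \<in> partial_classes G \<alpha> m U" and g: "g \<in> sym_power m"
    and agree: "\<And>e x. e \<in> down_arcs p \<Longrightarrow> \<alpha> e x = 0 \<Longrightarrow> g x = f (head G e) x"
  shows "f(p := g) \<in> partial_classes G \<alpha> m (insert p U)"
proof -
  let ?f = "f(p := g)"
  have "?f (tail G e) x = ?f (head G e) x"
    if e: "e \<in> arcs G" "tail G e \<in> insert p U" "head G e \<in> insert p U" "\<alpha> e x = 0" for e x
  proof -
    consider "tail G e = p" | "head G e = p" | "tail G e \<noteq> p" "head G e \<noteq> p" by blast
    then show ?thesis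
    proof cases
      case 1
      with new_vertex_arc[OF U e(1) 1 e(3)] U(2) agree e(4) show ?thesis by auto
    next
      case 2
      have "arev e \<in> down_arcs p \<and> tail G e \<in> U"
        using new_vertex_arc[OF U rev_in[OF e(1)]] tail_rev[OF e(1)] head_rev[OF e(1)] 2 e(2) by simp
      moreover have "\<alpha> (arev e) x = 0" using rev_value_iff(1)[OF e(1)] e(4) by simp
      ultimately show ?thesis using agree[of "arev e" x] head_rev[OF e(1)] 2 U(2) by auto
    next
      case 3
      then show ?thesis using e f by (auto simp: partial_classes_def)
    qed
  qed
  moreover have "?f q \<in> sym_power m" if "q \<in> insert p U" for q
    using f g that by (auto simp: partial_classes_def)
  moreover have "?f q = 0" if "q \<notin> insert p U" for q
    using f that by (simp add: partial_classes_def)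
  ultimately show ?thesis unfolding partial_classes_def by blast
qed

lemma partial_class_extends:
  assumes U: "lower_set U" "lower_set (insert p U)" "p \<notin> U" and f: "f \<in> partial_classes G \<alpha> m U"
  shows "\<exists>g\<in>sym_power m. f(p := g) \<in> partial_classes G \<alpha> m (insert p U)"
proof -
  have head: "head G e \<in> U" if "e \<in> down_arcs p" for e
    using U(2) down_arcsD[OF that] no_loops[of e] unfolding lower_set_def by auto
  have pow: "f (head G e) \<in> sym_power m" if "e \<in> down_arcs p" for e
    using f head[OF that] by (simp add: partial_classes_def)
  have "\<exists>g\<in>sym_algebra. \<forall>e\<in>down_arcs p. \<forall>x. \<alpha> e x = 0 \<longrightarrow> g x = f (head G e) x"
  proof (rule interpolation)
    show "finite (down_arcs p)" by (rule finite_down_arcs)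
    show "linear (\<alpha> e)" if "e \<in> down_arcs p" for e
      using axial_linear down_arcsD[OF that] by blast
    show "f (head G e) \<in> sym_algebra" if "e \<in> down_arcs p" for e
      using pow[OF that] sym_power_subset by blast
    show "f (head G i) x = f (head G j) x"
      if "i \<in> down_arcs p" "j \<in> down_arcs p" "\<alpha> i x = 0" "\<alpha> j x = 0" for i j x
      using lower_neighbours_agree[OF U(1) f that(1,2) _ head head that(3,4)] that(1,2) by blast
  qed (fact down_arcs_pair, fact down_arcs_triple)
  then obtain g where g: "g \<in> sym_algebra"
    "\<And>e x. e \<in> down_arcs p \<Longrightarrow> \<alpha> e x = 0 \<Longrightarrow> g x = f (head G e) x" by blast
  \<comment> \<open>The interpolant has no prescribed degree. On each hyperplane it agrees with a
    value of degree \<open>m\<close>, and hyperplanes are closed under scaling, so its degree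
    \<open>m\<close> component has the same restrictions.\<close>
  obtain k where k: "k \<in> sym_power m"
    "\<And>x. (\<forall>t>0. g (t *\<^sub>R x) = t ^ m * g x) \<Longrightarrow> k x = g x"
    using homogeneous_component[OF g(1)] by blast
  have "k x = f (head G e) x" if e: "e \<in> down_arcs p" "\<alpha> e x = 0" for e x
  proof -
    have "\<alpha> e (t *\<^sub>R x) = 0" for t
      using e axial_linear down_arcsD[OF e(1)] by (simp add: linear_cmul)
    then have "g (t *\<^sub>R x) = t ^ m * g x" for t
      using g(2) e sym_power_homogeneous[OF pow[OF e(1)]] by simp
    then show ?thesis using k(2) g(2)[OF e] by simp
  qed
  then have "f(p := k) \<in> partial_classes G \<alpha> m (insert p U)"
    by (rule partial_class_insertI[OF U(1,3) f k(1)])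
  with k(1) show ?thesis by blast
qed

end

lemma partial_classesD:
  assumes "f \<in> partial_classes G \<alpha> m U" "e \<in> arcs G" "tail G e \<in> U" "head G e \<in> U" "\<alpha> e x = 0"
  shows "f (tail G e) x = f (head G e) x"
  using assms unfolding partial_classes_def by blast

context non_cyclic_skeleton
begin

section \<open>Image and kernel of restriction, and the dimension count\<close>

lemma partial_classes_restrict:
  assumes U: "lower_set U" "lower_set (insert p U)" "p \<notin> U"
  shows "(\<lambda>f. f(p := 0)) ` partial_classes G \<alpha> m (insert p U) = partial_classes G \<alpha> m U"
proof
  show "(\<lambda>f. f(p := 0)) ` partial_classes G \<alpha> m (insert p U) \<subseteq> partial_classes G \<alpha> m U"
  proof (rule image_subsetI)
    fix f assume f: "f \<in> partial_classes G \<alpha> m (insert p U)"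
    show "f(p := 0) \<in> partial_classes G \<alpha> m U"
      unfolding partial_classes_def
    proof (intro CollectI conjI ballI allI impI)
      show "(f(p := 0)) q \<in> sym_power m" if "q \<in> U" for q
        using f U(3) that by (auto simp: partial_classes_def)
      show "(f(p := 0)) q = 0" if "q \<notin> U" for q
        using f that by (auto simp: partial_classes_def)
      show "(f(p := 0)) (tail G e) x = (f(p := 0)) (head G e) x"
        if "e \<in> arcs G" "tail G e \<in> U" "head G e \<in> U" "\<alpha> e x = 0" for e x
      proof -
        have "tail G e \<noteq> p" "head G e \<noteq> p" using that U(3) by auto
        then show ?thesis using f that by (simp add: partial_classes_def)
      qed
    qed
  qed
  show "partial_classes G \<alpha> m U \<subseteq> (\<lambda>f. f(p := 0)) ` partial_classes G \<alpha> m (insert p U)"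
  proof
    fix f assume f: "f \<in> partial_classes G \<alpha> m U"
    then obtain g where "f(p := g) \<in> partial_classes G \<alpha> m (insert p U)"
      using partial_class_extends[OF U] by blast
    moreover have "f p = 0" using f U(3) by (simp add: partial_classes_def)
    then have "f = (f(p := g))(p := 0)" by (simp add: fun_upd_idem)
    ultimately show "f \<in> (\<lambda>f. f(p := 0)) ` partial_classes G \<alpha> m (insert p U)"
      by (intro image_eqI[where x = "f(p := g)"])
  qed
qed

text \<open>This is the kernel of restriction from \<open>insert p U\<close> to \<open>U\<close>.
  Such a class is zero at every lower neighbour, so its value at \<open>p\<close> vanishes on the
  hyperplanes of all descending arcs and is a multiple of the product of their axial values.\<close>

lemma partial_classes_supported_at:
  assumes U: "lower_set U" "lower_set (insert p U)" "p \<notin> U"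
  defines "I \<equiv> down_arcs p"
  shows "partial_classes G \<alpha> m (insert p U) \<inter> {f. f(p := 0) = 0} =
    (if card I \<le> m then (\<lambda>g. (\<lambda>_. 0)(p := (\<Prod>e\<in>I. \<alpha> e) * g)) ` sym_power (m - card I) else {0})"
proof -
  have zero: "0 \<in> partial_classes G \<alpha> m U'" for U'
    by (rule real_vector.subspace_0[OF subspace_partial_classes])
  have lin_I: "\<forall>e\<in>I. linear (\<alpha> e)" using axial_linear down_arcsD unfolding I_def by blast
  have ne: "\<exists>w. \<alpha> e w \<noteq> 0" if "e \<in> I" for e
    using that value_nonzero down_arcsD unfolding I_def by blast
  have supp: "if card I \<le> m then \<exists>g\<in>sym_power (m - card I). f p = (\<Prod>e\<in>I. \<alpha> e) * g else f p = 0"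
    and rest: "f = (\<lambda>_. 0)(p := f p)"
    if f: "f \<in> partial_classes G \<alpha> m (insert p U)" "f(p := 0) = 0" for f
  proof -
    have off: "f q = 0" if "q \<noteq> p" for q using fun_cong[OF f(2), of q] that by simp
    then show "f = (\<lambda>_. 0)(p := f p)" by (simp add: fun_eq_iff)
    have van: "f p x = 0" if e: "e \<in> I" "\<alpha> e x = 0" for e x
    proof -
      have eG: "e \<in> arcs G" "tail G e = p" "\<alpha> e \<xi> < 0"
        using down_arcsD e(1) by (auto simp: I_def)
      then have "head G e \<in> insert p U" using U(2) unfolding lower_set_def by blast
      then have "f (tail G e) x = f (head G e) x"
        by (intro partial_classesD[OF f(1) eG(1) _ _ e(2)]) (simp_all add: eG(2))
      then show ?thesis using off[of "head G e"] no_loops[OF eG(1)] eG(2) by simp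
    qed
    have pow: "f p \<in> sym_power m" using f(1) by (simp add: partial_classes_def)
    show "if card I \<le> m then \<exists>g\<in>sym_power (m - card I). f p = (\<Prod>e\<in>I. \<alpha> e) * g else f p = 0"
    proof (rule multiples_in_sym_power[OF _ _ ne _ pow van])
      show "finite I" unfolding I_def by (rule finite_down_arcs)
      show "linear (\<alpha> e)" if "e \<in> I" for e using lin_I that by blast
      show "\<exists>w. \<alpha> i w \<noteq> 0 \<and> \<alpha> j w = 0" if "i \<in> I" "j \<in> I" "i \<noteq> j" for i j
        using that unfolding I_def by (rule down_arcs_pair)
    qed
  qed
  have conv: "(\<lambda>_. 0)(p := (\<Prod>e\<in>I. \<alpha> e) * g) \<in> partial_classes G \<alpha> m (insert p U)"
    if "card I \<le> m" "g \<in> sym_power (m - card I)" for g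
  proof -
    have "(\<Prod>e\<in>I. \<alpha> e) * g \<in> sym_power m"
      using prod_mult_sym_power[of I \<alpha> g "m - card I"] that lin_I finite_down_arcs[of p]
      by (simp add: I_def)
    then have "0(p := (\<Prod>e\<in>I. \<alpha> e) * g) \<in> partial_classes G \<alpha> m (insert p U)"
      by (rule partial_class_insertI[OF U(1,3) zero])
        (auto simp: prod_fun_apply I_def finite_down_arcs)
    then show ?thesis by (simp add: zero_fun_def)
  qed
  show ?thesis
  proof (cases "card I \<le> m")
    case True
    have "f \<in> (\<lambda>g. (\<lambda>_. 0)(p := (\<Prod>e\<in>I. \<alpha> e) * g)) ` sym_power (m - card I)"
      if f: "f \<in> partial_classes G \<alpha> m (insert p U)" "f(p := 0) = 0" for f
    proof -
      obtain g where g: "g \<in> sym_power (m - card I)" "f p = (\<Prod>e\<in>I. \<alpha> e) * g"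
        using supp[OF f] True by auto
      then have "f = (\<lambda>_. 0)(p := (\<Prod>e\<in>I. \<alpha> e) * g)"
        using rest[OF f] by simp
      with g(1) show ?thesis by blast
    qed
    moreover have "((\<lambda>_. 0)(p := h))(p := 0) = 0" for h :: "'g \<Rightarrow> real"
      by (simp add: fun_eq_iff)
    ultimately show ?thesis using True conv by auto
  next
    case False
    have "f = 0" if "f \<in> partial_classes G \<alpha> m (insert p U)" "f(p := 0) = 0" for f
    proof -
      have "f p = 0" using supp[OF that] False by simp
      then show ?thesis using that(2) by (metis fun_upd_triv)
    qed
    moreover have "(0 :: 'v \<Rightarrow> 'g \<Rightarrow> real)(p := 0) = 0" by (simp add: fun_eq_iff)
    ultimately show ?thesis using False zero by auto
  qed
qed

text \<open>Multiplication by the product is injective, because every factor is nonzero at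
  \<open>\<xi>\<close> and can be cancelled.\<close>

lemma dim_partial_classes_supported_at:
  assumes U: "lower_set U" "lower_set (insert p U)" "p \<notin> U"
  shows "finite_dim (partial_classes G \<alpha> m (insert p U) \<inter> {f. f(p := 0) = 0}) \<and>
    dim (partial_classes G \<alpha> m (insert p U) \<inter> {f. f(p := 0) = 0}) =
      sym_dim TYPE('g) (int m - int (vertex_index G \<alpha> \<xi> p))"
proof (cases "card (down_arcs p) \<le> m")
  case True
  let ?T = "\<lambda>g. (\<lambda>_. 0)(p := (\<Prod>e\<in>down_arcs p. \<alpha> e) * g) :: 'v \<Rightarrow> 'g \<Rightarrow> real"
  let ?S = "sym_power (m - card (down_arcs p)) :: ('g \<Rightarrow> real) set"
  have "finite_dim (?T ` ?S) \<and> dim (?T ` ?S) = dim ?S"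
  proof (rule dim_image_inj)
    show "linear ?T" by (auto simp: linear_iff fun_eq_iff algebra_simps)
    show "finite_dim ?S" by (rule finite_dim_sym_power[OF fin_dim])
    show "subspace ?S" by (rule subspace_sym_power)
    fix g assume g: "g \<in> ?S" "?T g = 0"
    have "(\<Prod>e\<in>down_arcs p. \<alpha> e) * g = 0"
      using fun_cong[OF g(2), of p] by (simp del: times_fun_apply)
    then have 0: "(\<Prod>e\<in>down_arcs p. \<alpha> e x) * g x = 0" for x
      using prod_fun_apply[of \<alpha> "down_arcs p" x] by (metis times_fun_apply zero_fun_apply)
    have "g x = 0" for x
      by (rule vanish_of_prod_mult[OF finite_down_arcs real_vector.subspace_UNIV _ _ _ 0 UNIV_I])
        (use g(1) sym_power_subset axial_linear value_nonzero down_arcsD in blast)+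
    then show "g = 0" by (simp add: fun_eq_iff)
  qed
  moreover have "sym_dim TYPE('g) (int m - int (vertex_index G \<alpha> \<xi> p)) = dim ?S"
    using True by (simp add: sym_dim_def card_down_arcs nat_diff_distrib)
  ultimately show ?thesis
    using True partial_classes_supported_at[OF U] by simp
next
  case False
  have "dim {0 :: 'v \<Rightarrow> 'g \<Rightarrow> real} = 0"
    using real_vector.dim_le_card[of "{0 :: 'v \<Rightarrow> 'g \<Rightarrow> real}" "{}"] by simp
  moreover have "finite_dim {0 :: 'v \<Rightarrow> 'g \<Rightarrow> real}"
    unfolding finite_dim_def using real_vector.span_zero by blast
  \<comment> \<open>The index exceeds \<open>m\<close>, so the integer argument of
    \<open>sym_dim\<close> is negative and its value is 0.\<close>
  ultimately show ?thesis
    using False partial_classes_supported_at[OF U] by (simp add: sym_dim_def card_down_arcs)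
qed

lemma dim_partial_classes:
  assumes "lower_set U"
  shows "finite_dim (partial_classes G \<alpha> m U) \<and>
    dim (partial_classes G \<alpha> m U) = (\<Sum>p\<in>U. sym_dim TYPE('g) (int m - int (vertex_index G \<alpha> \<xi> p)))"
  using assms
proof (induction "card U" arbitrary: U rule: less_induct)
  case less
  have finU: "finite U" using less.prems fin_verts finite_subset unfolding lower_set_def by blast
  show ?case
  proof (cases "U = {}")
    case True
    have "partial_classes G \<alpha> m {} = {0}" by (auto simp: partial_classes_def fun_eq_iff)
    moreover have "dim {0 :: 'v \<Rightarrow> 'g \<Rightarrow> real} = 0"
      using real_vector.dim_le_card[of "{0 :: 'v \<Rightarrow> 'g \<Rightarrow> real}" "{}"] by simp
    moreover have "finite_dim {0 :: 'v \<Rightarrow> 'g \<Rightarrow> real}"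
      unfolding finite_dim_def using real_vector.span_zero by blast
    ultimately show ?thesis using True by simp
  next
    case False
    \<comment> \<open>A top vertex \<open>p\<close> of \<open>U\<close> is removed: no arc starting
      in the rest of \<open>U\<close> descends to \<open>p\<close>, so the rest is again a lower
      set.\<close>
    have "wf ((arcs_ends (up_graph G \<alpha> \<xi>))\<inverse>)"
      by (rule finite_acyclic_wf_converse[OF finite_up up_acyclic])
    with False obtain p where p: "p \<in> U"
      and top: "\<And>q. (q, p) \<in> (arcs_ends (up_graph G \<alpha> \<xi>))\<inverse> \<Longrightarrow> q \<notin> U"
      by (metis wfE_min ex_in_conv)
    let ?V = "U - {p}"
    have U: "insert p ?V = U" using p by blast
    have V: "lower_set ?V"
      unfolding lower_set_def
    proof (intro conjI ballI impI)
      show "?V \<subseteq> verts G" using less.prems by (auto simp: lower_set_def)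
      fix e assume e: "e \<in> arcs G" "tail G e \<in> ?V" "\<alpha> e \<xi> < 0"
      then have "head G e \<in> U" using less.prems by (auto simp: lower_set_def)
      moreover have "head G e \<noteq> p" using top down_arc_up[OF e(1,3)] e(2) by blast
      ultimately show "head G e \<in> ?V" by blast
    qed
    have lowU: "lower_set (insert p ?V)" using less.prems U by simp
    have IH: "finite_dim (partial_classes G \<alpha> m ?V)"
      "dim (partial_classes G \<alpha> m ?V) = (\<Sum>p\<in>?V. sym_dim TYPE('g) (int m - int (vertex_index G \<alpha> \<xi> p)))"
      using less.hyps[OF card_Diff1_less[OF finU p] V] by blast+
    let ?T = "\<lambda>f :: 'v \<Rightarrow> 'g \<Rightarrow> real. f(p := 0)"
    have T: "linear ?T" by (auto simp: linear_iff fun_eq_iff)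
    have "p \<notin> ?V" by blast
    note restrict = partial_classes_restrict[OF V lowU this, of m, unfolded U]
      and supported = dim_partial_classes_supported_at[OF V lowU this, of m, unfolded U]
    have "finite_dim (partial_classes G \<alpha> m U) \<and>
        dim (partial_classes G \<alpha> m U) = dim (?T ` partial_classes G \<alpha> m U)
          + dim (partial_classes G \<alpha> m U \<inter> {f. f(p := 0) = 0})"
      by (rule rank_nullity[OF T subspace_partial_classes])
        (simp add: restrict IH(1), use supported in blast)
    then show ?thesis
      using restrict supported IH(2) by (simp add: sum.remove[OF finU p])
  qed
qed

text \<open>A nonzero linear form divides every polynomial vanishing on its kernel, and
  \<open>\<xi>\<close> witnesses that \<open>\<alpha> e\<close> is nonzero.\<close>

lemma cohomology_part_eq: "cohomology_part G \<alpha> m = partial_classes G \<alpha> m (verts G)"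
proof
  show "cohomology_part G \<alpha> m \<subseteq> partial_classes G \<alpha> m (verts G)"
  proof
    fix f assume f: "f \<in> cohomology_part G \<alpha> m"
    have "f (tail G e) x = f (head G e) x" if e: "e \<in> arcs G" "\<alpha> e x = 0" for e x
    proof -
      obtain q where "f (tail G e) - f (head G e) = \<alpha> e * q"
        using f e(1) by (auto simp: cohomology_part_def cohomology_def)
      from fun_cong[OF this, of x] e(2) show ?thesis by simp
    qed
    then show "f \<in> partial_classes G \<alpha> m (verts G)"
      using f by (simp add: cohomology_part_def cohomology_def partial_classes_def)
  qed
  show "partial_classes G \<alpha> m (verts G) \<subseteq> cohomology_part G \<alpha> m"
  proof
    fix f assume f: "f \<in> partial_classes G \<alpha> m (verts G)"
    then have pow: "f p \<in> sym_power m" if "p \<in> verts G" for p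
      using that by (simp add: partial_classes_def)
    then have alg: "f p \<in> sym_algebra" if "p \<in> verts G" for p
      using that sym_power_subset by blast
    have "\<exists>q\<in>sym_algebra. f (tail G e) - f (head G e) = \<alpha> e * q" if e: "e \<in> arcs G" for e
    proof -
      have "f (tail G e) - f (head G e) \<in> sym_algebra"
        using alg e by (intro real_vector.subspace_diff[OF subspace_sym_algebra]) auto
      moreover have "(f (tail G e) - f (head G e)) x = 0" if "\<alpha> e x = 0" for x
        using f e that by (simp add: partial_classes_def)
      ultimately obtain q where "q \<in> sym_algebra" "\<forall>x\<in>UNIV. (f (tail G e) - f (head G e)) x = \<alpha> e x * q x"
        using linear_dvd_on[OF real_vector.subspace_UNIV UNIV_I axial_linear[OF e] value_nonzero[OF e]]
        by metis
      then show ?thesis by (intro bexI[of _ q]) (auto simp: fun_eq_iff)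
    qed
    then show "f \<in> cohomology_part G \<alpha> m"
      using f pow alg by (simp add: cohomology_part_def cohomology_def partial_classes_def)
  qed
qed

lemma dim_cohomology_part:
  "finite_dim (cohomology_part G \<alpha> m) \<and>
    dim (cohomology_part G \<alpha> m) = (\<Sum>k=0..d. betti G \<alpha> k * sym_dim TYPE('g) (int m - int k))"
proof -
  let ?i = "vertex_index G \<alpha> \<xi>"
  have "lower_set (verts G)" by (simp add: lower_set_def)
  note dim = dim_partial_classes[OF this, of m]
  \<comment> \<open>The valence bounds the index, so grouping the vertices by index stays within
    \<open>0..d\<close>.\<close>
  have "?i p \<le> d" if "p \<in> verts G" for p
    unfolding vertex_index_def valent[OF that, symmetric] by (rule card_mono) auto
  then have "(\<Sum>p\<in>verts G. sym_dim TYPE('g) (int m - int (?i p)))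
      = (\<Sum>k=0..d. \<Sum>p | p \<in> verts G \<and> ?i p = k. sym_dim TYPE('g) (int m - int (?i p)))"
    by (intro sum.group[symmetric]) auto
  also have "\<dots> = (\<Sum>k=0..d. betti G \<alpha> k * sym_dim TYPE('g) (int m - int k))"
    by (intro sum.cong) (auto simp: betti_eq_index_count[OF polarizing] index_count_def)
  finally show ?thesis using dim by (simp add: cohomology_part_eq)
qed

end

theorem theorem2p4p1:
  fixes G :: "('v, 'e) pre_digraph" and arev :: "'e \<Rightarrow> 'e"
    and d n m :: nat
    and \<theta> :: "'e \<Rightarrow> 'e \<Rightarrow> 'e"
    and \<alpha> :: "'e \<Rightarrow> 'g::real_vector \<Rightarrow> real"
  assumes "finite_dim (UNIV :: 'g set)" and "dim (UNIV :: 'g set) = n"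
    and "abstract_one_skeleton G arev d \<theta> \<alpha>"
    and "three_independent G \<alpha>"
    and "non_cyclic G \<alpha>"
  shows "finite_dim (cohomology_part G \<alpha> m) \<and>
    dim (cohomology_part G \<alpha> m) =
      (\<Sum>k=0..d. betti G \<alpha> k * sym_dim TYPE('g) (int m - int k))"
proof -
  obtain \<xi> where \<xi>: "\<xi> \<in> polarizing G \<alpha>" "\<nexists>c. pre_digraph.cycle (up_graph G \<alpha> \<xi>) c"
    using assms(5) unfolding non_cyclic_def up_graph_def by blast
  interpret abstract_one_skeleton G arev d \<theta> \<alpha> by fact
  interpret non_cyclic_skeleton G arev d \<theta> \<alpha> \<xi>
    using assms(1,4,5) \<xi> unfolding non_cyclic_def by unfold_locales blast+
  show ?thesis by (rule dim_cohomology_part)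
qed

end
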